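(* Let $\epsilon>0$ and $\eta=3^{3/2}2^{-1}$. Endow $\mathbf B_\epsilon$ and $\mathbf H$ with the metric induced by the norm $\|(a,b)\|_{\mathcal H}=(\|a\|_{L^2(\mathbb T)}^2+\|b\|_{L^2(\mathbb T)}^2)^{1/2}$. Then the map sending $(a,b)\in\mathbf B_\epsilon$ to the right factor $(a_+,b_+)\in\mathbf H$ of its unique factorization $(a,b)=(a_-,b_-)(a_+,b_+)$ with $(a_-,b_-)\in\mathbf H_0^*$, $(a_+,b_+)\in\mathbf H$, is Lipschitz with constant at most $(2^{5/2}+4)(\eta\epsilon)^{-3/2}$.
   Context: $\mathbb T$ unit circle, $\mathbb D$ open unit disc, $\mathbb D^*=\{\overline z^{-1}:z\in\mathbb D\}\cup\{\infty\}$, $a^*(z)=\overline{a(\overline z^{-1})}$. $H^2(\mathbb D)$: functions in $L^2(\mathbb T)$ with vanishing negative Fourier coefficients; $H^2(\mathbb D^* )$: $f$ with $f^*\in H^2(\mathbb D)$, extended analytically to $\mathbb D^*$ with $f(\infty)=\overline{f^*(0)}$. Inner function: bounded analytic $g$ on $\mathbb D$ with $|g|=1$ a.e. on $\mathbb T$. Pairs multiply as $(a,b)(c,d)=(ac-bd^*,ad+bc^* )$. $\mathbf L$: pairs $(a,b)$ of measurable functions on $\mathbb T$ with $aa^*+bb^*=1$ a.e., $a\in H^2(\mathbb D^* )$, $a(\infty)>0$. $\overline{\mathbf H}$: $(a,b)\in\mathbf L$ with $b\in H^2(\mathbb D)$. $\mathbf H$: $(a,b)\in\overline{\mathbf H}$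 such that any inner $g$ with $a^*g^{-1},bg^{-1}\in H^2(\mathbb D)$ is constant. $\mathbf H_0^*$: $(a,b)\in\mathbf L$ with $(a,b^* )\in\mathbf H$ and $b^*(0)=0$. $\mathbf B$: $(a,b)\in\mathbf L$ with $\inf_{z\in\mathbb D^*}|a(z)|^2>\frac12$; every $(a,b)\in\mathbf B$ has a unique factorization as stated. $\mathbf B_\epsilon$: $(a,b)\in\mathbf B$ with $\inf_{z\in\mathbb D^*}|a(z)|\ge2^{-1/2}+\epsilon$. *)

theory Defs
  imports "HOL-Analysis.Analysis"
begin

text \<open>Functions on the unit circle T are represented as maps complex => complex,
  only their values on T matter. T is parametrised by t in [0,2pi] via cis t,
  with normalised arc-length measure dt/(2 pi).\<close>

definition Tmeas :: "real measure" where
  "Tmeas = lebesgue_on {0..2*pi}"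

definition Tmeasurable :: "(complex \<Rightarrow> complex) \<Rightarrow> bool" where
  "Tmeasurable f \<longleftrightarrow> (\<lambda>t. f (cis t)) \<in> borel_measurable Tmeas"

definition L2T :: "(complex \<Rightarrow> complex) set" where
  "L2T = {f. Tmeasurable f \<and> integrable Tmeas (\<lambda>t. (norm (f (cis t)))\<^sup>2)}"

definition L2norm :: "(complex \<Rightarrow> complex) \<Rightarrow> real" where
  "L2norm f = sqrt ((1 / (2*pi)) * integral\<^sup>L Tmeas (\<lambda>t. (norm (f (cis t)))\<^sup>2))"

definition fourier :: "(complex \<Rightarrow> complex) \<Rightarrow> int \<Rightarrow> complex" where
  "fourier f n = (1 / (2*pi)) * integral\<^sup>L Tmeas (\<lambda>t. f (cis t) * cis (- (real_of_int n) * t))"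

definition star :: "(complex \<Rightarrow> complex) \<Rightarrow> complex \<Rightarrow> complex" where
  "star f z = cnj (f (inverse (cnj z)))"

definition H2D :: "(complex \<Rightarrow> complex) set" where
  "H2D = {f. f \<in> L2T \<and> (\<forall>n<0. fourier f n = 0)}"

definition H2ext :: "(complex \<Rightarrow> complex) \<Rightarrow> complex \<Rightarrow> complex" where
  "H2ext f w = (\<Sum>n. fourier f (int n) * w ^ n)"

definition H2Dstar :: "(complex \<Rightarrow> complex) set" where
  "H2Dstar = {f. star f \<in> H2D}"

text \<open>Extension of f in H^2(D^*) to the finite part {|z|>1} of D^*, and its value at infinity.\<close>
definition ext_out :: "(complex \<Rightarrow> complex) \<Rightarrow> complex \<Rightarrow> complex" where
  "ext_out f z = cnj (H2ext (star f) (inverse (cnj z)))"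

definition at_inf :: "(complex \<Rightarrow> complex) \<Rightarrow> complex" where
  "at_inf f = cnj (H2ext (star f) 0)"

definition inf_Dstar_abs :: "(complex \<Rightarrow> complex) \<Rightarrow> real" where
  "inf_Dstar_abs f = Inf ({norm (ext_out f z) | z. norm z > 1} \<union> {norm (at_inf f)})"

definition inner :: "(complex \<Rightarrow> complex) \<Rightarrow> bool" where
  "inner g \<longleftrightarrow> g holomorphic_on ball 0 1 \<and> bounded (g ` ball 0 1) \<and>
     (AE t in Tmeas. \<exists>l. ((\<lambda>r::real. g (of_real r * cis t)) \<longlongrightarrow> l) (at_left 1) \<and> norm l = 1)"

definition bdry :: "(complex \<Rightarrow> complex) \<Rightarrow> complex \<Rightarrow> complex" where
  "bdry g z = Lim (at_left (1::real)) (\<lambda>r. g (of_real r * z))"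

definition pmul :: "(complex \<Rightarrow> complex) \<times> (complex \<Rightarrow> complex) \<Rightarrow>
    (complex \<Rightarrow> complex) \<times> (complex \<Rightarrow> complex) \<Rightarrow> (complex \<Rightarrow> complex) \<times> (complex \<Rightarrow> complex)" where
  "pmul p q = (case p of (a, b) \<Rightarrow> case q of (c, d) \<Rightarrow>
     (\<lambda>z. a z * c z - b z * star d z, \<lambda>z. a z * d z + b z * star c z))"

definition pair_eq_ae :: "(complex \<Rightarrow> complex) \<times> (complex \<Rightarrow> complex) \<Rightarrow>
    (complex \<Rightarrow> complex) \<times> (complex \<Rightarrow> complex) \<Rightarrow> bool" where
  "pair_eq_ae p q \<longleftrightarrow> (AE t in Tmeas. fst p (cis t) = fst q (cis t) \<and> snd p (cis t) = snd q (cis t))"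

definition Lset :: "((complex \<Rightarrow> complex) \<times> (complex \<Rightarrow> complex)) set" where
  "Lset = {(a, b). Tmeasurable a \<and> Tmeasurable b \<and>
      (AE t in Tmeas. a (cis t) * star a (cis t) + b (cis t) * star b (cis t) = 1) \<and>
      a \<in> H2Dstar \<and> at_inf a \<in> \<real> \<and> Re (at_inf a) > 0}"

definition Hbar :: "((complex \<Rightarrow> complex) \<times> (complex \<Rightarrow> complex)) set" where
  "Hbar = {(a, b). (a, b) \<in> Lset \<and> b \<in> H2D}"

definition Hset :: "((complex \<Rightarrow> complex) \<times> (complex \<Rightarrow> complex)) set" where
  "Hset = {(a, b). (a, b) \<in> Hbar \<and>
     (\<forall>g. inner g \<and> (\<lambda>z. star a z / bdry g z) \<in> H2D \<and> (\<lambda>z. b z / bdry g z) \<in> H2D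
          \<longrightarrow> (\<exists>c. \<forall>z\<in>ball 0 1. g z = c))}"

definition H0star :: "((complex \<Rightarrow> complex) \<times> (complex \<Rightarrow> complex)) set" where
  "H0star = {(a, b). (a, b) \<in> Lset \<and> (a, star b) \<in> Hset \<and> H2ext (star b) 0 = 0}"

definition Bset :: "((complex \<Rightarrow> complex) \<times> (complex \<Rightarrow> complex)) set" where
  "Bset = {(a, b). (a, b) \<in> Lset \<and> (inf_Dstar_abs a)\<^sup>2 > 1/2}"

definition Beps :: "real \<Rightarrow> ((complex \<Rightarrow> complex) \<times> (complex \<Rightarrow> complex)) set" where
  "Beps \<epsilon> = {(a, b). (a, b) \<in> Bset \<and> inf_Dstar_abs a \<ge> 2 powr (-1/2) + \<epsilon>}"

definition Hdist :: "(complex \<Rightarrow> complex) \<times> (complex \<Rightarrow> complex) \<Rightarrow>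
    (complex \<Rightarrow> complex) \<times> (complex \<Rightarrow> complex) \<Rightarrow> real" where
  "Hdist p q = sqrt ((L2norm (\<lambda>z. fst p z - fst q z))\<^sup>2 + (L2norm (\<lambda>z. snd p z - snd q z))\<^sup>2)"

end

theory Submission
  imports Defs "HOL-Complex_Analysis.Complex_Analysis" "HOL-Real_Asymp.Real_Asymp"
begin

text \<open>
  Put \<open>r = b/a\<close> and \<open>s = a(\<infinity>)/a\<^sub>-(\<infinity>)\<close>. Solving the factorization for the left factor gives
  \<open>a\<^sub>-\<^sup>*/a\<^sup>* = a\<^sub>+ + r\<^sup>* b\<^sub>+\<close>, which lies in \<open>H\<^sup>2(D)\<close> and has mean \<open>1/s\<close>, and
  \<open>b\<^sub>-/a = r a\<^sub>+ - b\<^sub>+\<close>, which lies in \<open>H\<^sup>2(D\<^sup>*)\<close> and vanishes at infinity. So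
  \<open>(A, B) = s (a\<^sub>+, b\<^sub>+)\<close> solves a linear system of the form identity plus antisymmetric operator.
  Subtracting the systems of two data and pairing with the difference of the solutions, the
  antisymmetric part cancels, and since \<open>|A'|\<^sup>2 + |B'|\<^sup>2 = s'\<^sup>2\<close> this leaves
  \<open>\<parallel>(A, B) - (A', B')\<parallel> \<le> s' \<parallel>r - r'\<parallel>\<close>. Scaling two unit vectors by \<open>s\<close> and \<open>s'\<close> multiplies
  their distance by at least \<open>sqrt (s s')\<close>; taking \<open>s' \<le> s\<close> without loss of generality, the map
  from \<open>r\<close> to the right factor is a contraction. As \<open>|a|\<^sup>2 \<ge> 1/2\<close>, the quotient \<open>r\<close> is
  2-Lipschitz in \<open>(a, b)\<close>, so the constant 2 suffices; it is at most the stated one because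
  \<open>\<epsilon> \<le> 1 - 2\<^sup>-\<^sup>1\<^sup>/\<^sup>2\<close>.
\<close>

section \<open>Square-integrable functions on the circle\<close>

text \<open>Phrased for functions of the angle instead of points of the circle, because partial
  sums, dilations and the quotients \<open>h\<close>, \<open>k\<close> below are all given in terms
  of \<open>t\<close>.\<close>

definition sq_integrable :: "(real \<Rightarrow> complex) \<Rightarrow> bool" where
  "sq_integrable F \<longleftrightarrow> F \<in> borel_measurable Tmeas \<and> integrable Tmeas (\<lambda>t. (norm (F t))\<^sup>2)"

lemma L2T_iff: "f \<in> L2T \<longleftrightarrow> sq_integrable (\<lambda>t. f (cis t))"
  by (simp add: L2T_def sq_integrable_def Tmeasurable_def)

interpretation Tmeas: finite_measure Tmeas
  unfolding Tmeas_def by (rule finite_measure_lebesgue_on) simp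

lemma space_Tmeas [simp]: "space Tmeas = {0..2*pi}"
  by (simp add: Tmeas_def)

lemma integral_Tmeas_const: "(\<integral>t. c \<partial>Tmeas) = (2 * pi) *\<^sub>R (c :: 'a :: {banach, second_countable_topology})"
  by (simp add: Tmeas_def measure_restrict_space)

lemma continuous_measurable_Tmeas:
  fixes F :: "real \<Rightarrow> 'a :: euclidean_space"
  assumes "continuous_on UNIV F"
  shows "F \<in> borel_measurable Tmeas"
  unfolding Tmeas_def
  by (intro continuous_imp_measurable_on_sets_lebesgue continuous_on_subset[OF assms]) auto

lemma cis_measurable [measurable]: "(\<lambda>t. cis (x * t)) \<in> borel_measurable Tmeas"
  by (intro continuous_measurable_Tmeas continuous_intros)

lemma sq_integrable_bounded:
  assumes "F \<in> borel_measurable Tmeas" "AE t in Tmeas. norm (F t) \<le> B"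
  shows "sq_integrable F"
  unfolding sq_integrable_def
proof
  have "AE t in Tmeas. norm ((norm (F t))\<^sup>2) \<le> B\<^sup>2"
    using assms(2) by eventually_elim (auto intro: power_mono)
  then show "integrable Tmeas (\<lambda>t. (norm (F t))\<^sup>2)"
    using assms(1) by (intro Tmeas.integrable_const_bound[where B = "B\<^sup>2"]) auto
qed fact

lemma sq_integrable_mult:
  assumes "sq_integrable F" "sq_integrable G"
  shows "integrable Tmeas (\<lambda>t. F t * G t)" "integrable Tmeas (\<lambda>t. norm (F t) * norm (G t))"
proof -
  have [measurable]: "F \<in> borel_measurable Tmeas" "G \<in> borel_measurable Tmeas"
    using assms by (auto simp: sq_integrable_def)
  have i: "integrable Tmeas (\<lambda>t. (norm (F t))\<^sup>2 + (norm (G t))\<^sup>2)"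
    using assms by (auto simp: sq_integrable_def)
  have bd: "x * y \<le> x\<^sup>2 + y\<^sup>2" if "x \<ge> 0" "y \<ge> 0" for x y :: real
    using sum_squares_bound[of x y] mult_nonneg_nonneg[OF that] by linarith
  show "integrable Tmeas (\<lambda>t. F t * G t)" "integrable Tmeas (\<lambda>t. norm (F t) * norm (G t))"
    by (intro Bochner_Integration.integrable_bound[OF i]; simp add: norm_mult bd)+
qed

lemma norm_add_sq_le: "(norm (x + y))\<^sup>2 \<le> 2 * (norm x)\<^sup>2 + 2 * (norm (y :: 'a :: real_normed_vector))\<^sup>2"
proof -
  have "(norm (x + y))\<^sup>2 \<le> (norm x + norm y)\<^sup>2"
    by (intro power_mono norm_triangle_ineq) auto
  then show ?thesis
    using sum_squares_bound[of "norm x" "norm y"] by (simp add: power2_sum)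
qed

lemma sq_integrable_add:
  assumes "sq_integrable F" "sq_integrable G"
  shows "sq_integrable (\<lambda>t. F t + G t)"
proof -
  have [measurable]: "F \<in> borel_measurable Tmeas" "G \<in> borel_measurable Tmeas"
    using assms by (auto simp: sq_integrable_def)
  have i: "integrable Tmeas (\<lambda>t. 2 * ((norm (F t))\<^sup>2 + (norm (G t))\<^sup>2))"
    using assms by (auto simp: sq_integrable_def)
  have "integrable Tmeas (\<lambda>t. (norm (F t + G t))\<^sup>2)"
    by (intro Bochner_Integration.integrable_bound[OF i]) (auto simp: norm_add_sq_le)
  then show ?thesis
    by (simp add: sq_integrable_def)
qed

lemma sq_integrable_bounded_mult:
  assumes "sq_integrable F" "G \<in> borel_measurable Tmeas" "AE t in Tmeas. norm (G t) \<le> B"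
  shows "sq_integrable (\<lambda>t. F t * G t)"
proof -
  have [measurable]: "F \<in> borel_measurable Tmeas" "G \<in> borel_measurable Tmeas"
    using assms by (auto simp: sq_integrable_def)
  have i: "integrable Tmeas (\<lambda>t. (norm (F t))\<^sup>2 * B\<^sup>2)"
    using assms by (auto simp: sq_integrable_def)
  have "AE t in Tmeas. norm ((norm (F t * G t))\<^sup>2) \<le> norm ((norm (F t))\<^sup>2 * B\<^sup>2)"
    using assms(3) by eventually_elim (auto simp: norm_mult power_mult_distrib intro!: mult_left_mono power_mono)
  then have "integrable Tmeas (\<lambda>t. (norm (F t * G t))\<^sup>2)"
    by (intro Bochner_Integration.integrable_bound[OF i]) auto
  then show ?thesis
    by (simp add: sq_integrable_def)
qed

lemma sq_integrable_const [simp]: "sq_integrable (\<lambda>t. c)"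
  by (rule sq_integrable_bounded[where B = "norm c"]) auto

lemma sq_integrable_cis [simp]: "sq_integrable (\<lambda>t. cis (x * t))"
  by (rule sq_integrable_bounded[where B = 1]) auto

lemma sq_integrable_cmult: "sq_integrable F \<Longrightarrow> sq_integrable (\<lambda>t. c * F t)"
  using sq_integrable_bounded_mult[of F "\<lambda>t. c" "norm c"] by (simp add: mult.commute)

lemma sq_integrable_diff:
  "sq_integrable F \<Longrightarrow> sq_integrable G \<Longrightarrow> sq_integrable (\<lambda>t. F t - G t)"
  using sq_integrable_add[of F "\<lambda>t. (-1) * G t"] sq_integrable_cmult[of G "-1"] by simp

lemma sq_integrable_sum:
  "(\<And>i. i \<in> A \<Longrightarrow> sq_integrable (F i)) \<Longrightarrow> sq_integrable (\<lambda>t. \<Sum>i\<in>A. F i t)"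
  by (induction A rule: infinite_finite_induct) (auto intro: sq_integrable_add)

lemma sq_integrable_integrable: "sq_integrable F \<Longrightarrow> integrable Tmeas F"
  using sq_integrable_mult(1)[of F "\<lambda>t. 1"] by simp

text \<open>The quadratic polynomial \<open>x\<^sup>2 * P - 2 * x * J + Q\<close> is the integral of
  a square for every real \<open>x\<close>, and its nonnegativity forces
  \<open>J\<^sup>2 \<le> P * Q\<close>.\<close>

lemma integral_Cauchy_Schwarz:
  assumes F: "sq_integrable F" and G: "sq_integrable G"
  shows "(norm (\<integral>t. F t * G t \<partial>Tmeas))\<^sup>2 \<le>
    (\<integral>t. (norm (F t))\<^sup>2 \<partial>Tmeas) * (\<integral>t. (norm (G t))\<^sup>2 \<partial>Tmeas)"
proof -
  define J P Q where "J = (\<integral>t. norm (F t) * norm (G t) \<partial>Tmeas)"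
    and "P = (\<integral>t. (norm (F t))\<^sup>2 \<partial>Tmeas)" and "Q = (\<integral>t. (norm (G t))\<^sup>2 \<partial>Tmeas)"
  have nn: "J \<ge> 0" "P \<ge> 0" "Q \<ge> 0"
    by (auto simp: J_def P_def Q_def)
  have i: "integrable Tmeas (\<lambda>t. (norm (F t))\<^sup>2)" "integrable Tmeas (\<lambda>t. (norm (G t))\<^sup>2)"
    using F G by (auto simp: sq_integrable_def)
  have quad: "0 \<le> x\<^sup>2 * P - 2 * x * J + Q" for x
  proof -
    have "0 \<le> (\<integral>t. (x * norm (F t) - norm (G t))\<^sup>2 \<partial>Tmeas)"
      by simp
    also have "\<dots> = (\<integral>t. (x\<^sup>2 * (norm (F t))\<^sup>2 - (2 * x) * (norm (F t) * norm (G t))) + (norm (G t))\<^sup>2 \<partial>Tmeas)"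
      by (intro Bochner_Integration.integral_cong) (auto simp: power2_diff power_mult_distrib)
    also have "\<dots> = x\<^sup>2 * P - 2 * x * J + Q"
      using i sq_integrable_mult(2)[OF F G]
      by (simp add: J_def P_def Q_def)
    finally show ?thesis .
  qed
  have JPQ: "J\<^sup>2 \<le> P * Q"
  proof (cases "P = 0")
    case True
    \<comment> \<open>With \<open>P = 0\<close> the polynomial is affine in \<open>x\<close>; were
      \<open>J\<close> nonzero, the chosen point would give it the value -1.\<close>
    then have "J = 0"
      using quad[of "(Q + 1) / (2 * J)"] by (cases "J = 0") auto
    then show ?thesis using nn by simp
  next
    case False
    then have "P > 0" using nn by simp
    then show ?thesis
      \<comment> \<open>The minimum of the quadratic is attained at \<open>J / P\<close>.\<close>
      using quad[of "J / P"] by (simp add: field_simps power2_eq_square)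
  qed
  have "norm (\<integral>t. F t * G t \<partial>Tmeas) \<le> J"
    unfolding J_def using integral_norm_bound[of Tmeas "\<lambda>t. F t * G t"] by (simp add: norm_mult)
  then have "(norm (\<integral>t. F t * G t \<partial>Tmeas))\<^sup>2 \<le> J\<^sup>2"
    by (rule power_mono) simp
  also note JPQ
  finally show ?thesis
    by (simp add: P_def Q_def)
qed

text \<open>Cauchy-Schwarz makes the pairing with a fixed \<open>G\<close> continuous in mean
  square. This is how integral identities for partial Fourier sums and for dilations pass to
  boundary values.\<close>

lemma integral_mult_tendsto:
  assumes F: "\<And>N. sq_integrable (F N)" "sq_integrable F'" and G: "sq_integrable G"
    and lim: "((\<lambda>N. \<integral>t. (norm (F N t - F' t))\<^sup>2 \<partial>Tmeas) \<longlongrightarrow> 0) net"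
  shows "((\<lambda>N. \<integral>t. F N t * G t \<partial>Tmeas) \<longlongrightarrow> (\<integral>t. F' t * G t \<partial>Tmeas)) net"
proof -
  let ?Q = "\<integral>t. (norm (G t))\<^sup>2 \<partial>Tmeas"
  have le: "norm ((\<integral>t. F N t * G t \<partial>Tmeas) - (\<integral>t. F' t * G t \<partial>Tmeas)) \<le>
      sqrt ((\<integral>t. (norm (F N t - F' t))\<^sup>2 \<partial>Tmeas) * ?Q)" for N
  proof -
    have "(\<integral>t. F N t * G t \<partial>Tmeas) - (\<integral>t. F' t * G t \<partial>Tmeas) = (\<integral>t. (F N t - F' t) * G t \<partial>Tmeas)"
      using sq_integrable_mult(1)[OF F(1) G] sq_integrable_mult(1)[OF F(2) G]
      by (simp add: left_diff_distrib)
    then show ?thesis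
      using integral_Cauchy_Schwarz[OF sq_integrable_diff[OF F(1)[of N] F(2)] G]
      by (simp add: real_le_rsqrt)
  qed
  have "((\<lambda>N. sqrt ((\<integral>t. (norm (F N t - F' t))\<^sup>2 \<partial>Tmeas) * ?Q)) \<longlongrightarrow> 0) net"
    using tendsto_real_sqrt[OF tendsto_mult_left_zero[OF lim]] by simp
  then have "((\<lambda>N. (\<integral>t. F N t * G t \<partial>Tmeas) - (\<integral>t. F' t * G t \<partial>Tmeas)) \<longlongrightarrow> 0) net"
    by (rule Lim_null_comparison[OF always_eventually[OF allI[OF le]]])
  then show ?thesis
    by (rule LIM_zero_cancel)
qed

lemma integral_cis:
  "(\<integral>t. cis (of_int n * t) \<partial>Tmeas) = (if n = 0 then 2 * pi else 0)"
proof (cases "n = 0")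
  case False
  have "(\<integral>t. cis (of_int n * t) \<partial>Tmeas) = integral {0..2*pi} (\<lambda>t. cis (of_int n * t))"
    using sq_integrable_integrable[OF sq_integrable_cis, of "of_int n"] unfolding Tmeas_def
    by (rule lebesgue_integral_eq_integral) auto
  also have "((\<lambda>t. cis (of_int n * t)) has_integral
      (exp (\<i> * of_int n * of_real (2*pi)) / (\<i> * of_int n) - exp (\<i> * of_int n * of_real 0) / (\<i> * of_int n))) {0..2*pi}"
  proof (rule fundamental_theorem_of_calculus)
    fix x :: real
    have "((\<lambda>z. exp (\<i> * of_int n * z) / (\<i> * of_int n)) has_field_derivative cis (of_int n * x)) (at (of_real x))"
      using False by (auto intro!: derivative_eq_intros simp: cis_conv_exp mult_ac)
    then show "((\<lambda>t. exp (\<i> * of_int n * of_real t) / (\<i> * of_int n)) has_vector_derivative cis (of_int n * x))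
        (at x within {0..2*pi})"
      by (rule has_vector_derivative_real_field)
  qed simp
  then have "integral {0..2*pi} (\<lambda>t. cis (of_int n * t)) =
      (exp (\<i> * of_int n * of_real (2*pi)) - 1) / (\<i> * of_int n)"
    by (simp add: integral_unique diff_divide_distrib)
  also have "exp (\<i> * of_int n * of_real (2*pi)) = cis (2 * pi * of_int n)"
    by (simp add: cis_conv_exp mult_ac)
  also have "\<dots> = 1"
    by (rule cis_multiple_2pi) simp
  finally show ?thesis using False by simp
qed (simp add: integral_Tmeas_const scaleR_conv_of_real del: Bochner_Integration.lebesgue_integral_const)

section \<open>Density of trigonometric polynomials\<close>

text \<open>Generated by closure rules so that stability under products and the form as a finite sum
  over frequencies both follow by rule induction.\<close>

inductive_set trig_polys :: "(real \<Rightarrow> complex) set" where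
  cis: "(\<lambda>t. cis (of_int n * t)) \<in> trig_polys"
| cmult: "P \<in> trig_polys \<Longrightarrow> (\<lambda>t. c * P t) \<in> trig_polys"
| add: "P \<in> trig_polys \<Longrightarrow> Q \<in> trig_polys \<Longrightarrow> (\<lambda>t. P t + Q t) \<in> trig_polys"

lemma trig_polys_mult:
  assumes "P \<in> trig_polys" "Q \<in> trig_polys"
  shows "(\<lambda>t. P t * Q t) \<in> trig_polys"
  using assms(1)
proof induction
  case (cis n)
  show ?case
    using assms(2)
  proof induction
    case (cis m)
    have "(\<lambda>t. cis (of_int n * t) * cis (of_int m * t)) = (\<lambda>t. cis (of_int (n + m) * t))"
      by (simp add: cis_mult distrib_right)
    then show ?case
      using trig_polys.cis[of "n + m"] by simp
  next
    case (cmult P c)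
    then show ?case
      using trig_polys.cmult[of _ c] by (simp add: mult_ac)
  next
    case (add P Q)
    then show ?case
      using trig_polys.add by (simp add: distrib_left)
  qed
next
  case (cmult P c)
  then show ?case
    using trig_polys.cmult[of _ c] by (simp add: mult_ac)
next
  case (add P Q)
  then show ?case
    using trig_polys.add by (simp add: distrib_right)
qed

lemma trig_polys_const: "(\<lambda>t. c) \<in> trig_polys"
  using trig_polys.cmult[OF trig_polys.cis[of 0], of c] by simp

text \<open>A real linear functional on the plane restricts to a combination of \<open>cos t\<close>
  and \<open>sin t\<close>, hence of \<open>cis t\<close> and \<open>cis (- t)\<close>; the
  remaining cases are closure properties.\<close>

lemma trig_polys_real_polynomial:
  "real_polynomial_function p \<Longrightarrow> (\<lambda>t. of_real (p (cis t))) \<in> trig_polys"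
proof (induction rule: real_polynomial_function.induct)
  case (linear f)
  then interpret bounded_linear f .
  have "f (cis t) = f (cos t *\<^sub>R 1 + sin t *\<^sub>R \<i>)" for t
    by (rule arg_cong[of _ _ f]) (simp add: complex_eq_iff)
  then have f: "f (cis t) = cos t * f 1 + sin t * f \<i>" for t
    by (simp add: add scaleR)
  have "complex_of_real (f (cis t)) = (of_real (f 1) / 2 - \<i> * of_real (f \<i>) / 2) * cis (of_int 1 * t) +
      (of_real (f 1) / 2 + \<i> * of_real (f \<i>) / 2) * cis (of_int (- 1) * t)" for t
    by (simp add: f complex_eq_iff field_simps)
  then show ?case
    using trig_polys.add[OF trig_polys.cmult[OF trig_polys.cis[of 1]] trig_polys.cmult[OF trig_polys.cis[of "-1"]]]
    by presburger
next
  case (const c)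
  then show ?case by (rule trig_polys_const)
next
  case (add f g)
  then show ?case using trig_polys.add by simp
next
  case (mult f g)
  then show ?case using trig_polys_mult by simp
qed

text \<open>Periodicity turns \<open>h\<close> into a continuous function on the unit circle, which
  the Stone-Weierstrass theorem approximates by polynomials in the real and imaginary parts; on the
  circle these are trigonometric polynomials.\<close>

lemma trig_polys_uniformly_dense:
  fixes h :: "real \<Rightarrow> complex"
  assumes cont: "continuous_on UNIV h" and per: "h 0 = h (2 * pi)" and "e > 0"
  obtains P where "P \<in> trig_polys" "\<And>t. t \<in> {0..2*pi} \<Longrightarrow> norm (h t - P t) < e"
proof -
  define p where "p s = h (2 * pi * s)" for s
  define \<phi> where "\<phi> = p \<circ> (\<lambda>z. Arg2pi z / (2 * pi))"
  have "path p"
    unfolding path_def p_def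
    by (intro continuous_on_compose2[OF cont] continuous_intros) auto
  \<comment> \<open>The homotopy is the trivial one. Its use is that a loop induces a continuous map
    of the circle, also at 1, where \<open>Arg2pi\<close> jumps.\<close>
  then have "homotopic_loops UNIV p p"
    by (simp add: homotopic_loops_refl pathfinish_def pathstart_def p_def per)
  then have cont\<phi>: "continuous_on (sphere 0 1) \<phi>"
    unfolding \<phi>_def using homotopic_loops_imp_homotopic_circlemaps homotopic_with_imp_continuous by blast
  have \<phi>: "\<phi> (cis t) = h t" if t: "t \<in> {0..2*pi}" for t
  \<comment> \<open>The angle \<open>2 * pi\<close> is the one point where
    \<open>Arg2pi (cis t)\<close> is 0 and not \<open>t\<close>; there periodicity of
    \<open>h\<close> is used.\<close>
  proof (cases "t = 2 * pi")
    case True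
    then show ?thesis
      using Arg2pi_of_real[of 1] by (simp add: \<phi>_def p_def per)
  next
    case False
    then have "Arg2pi (cis t) = t"
      using t by (intro Arg2pi_unique[of 1]) (auto simp: cis_conv_exp)
    then show ?thesis
      by (simp add: \<phi>_def p_def)
  qed
  obtain g where g: "polynomial_function g" "\<And>z. z \<in> sphere 0 1 \<Longrightarrow> norm (\<phi> z - g z) < e"
    using Stone_Weierstrass_polynomial_function[OF compact_sphere cont\<phi> \<open>e > 0\<close>] by blast
  show thesis
  proof
    have "real_polynomial_function (\<lambda>z. Re (g z))" "real_polynomial_function (\<lambda>z. Im (g z))"
      using g(1) bounded_linear_Re bounded_linear_Im by (auto simp: polynomial_function_def o_def)
    then have "(\<lambda>t. of_real (Re (g (cis t))) + \<i> * of_real (Im (g (cis t)))) \<in> trig_polys"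
      by (intro trig_polys.add trig_polys.cmult trig_polys_real_polynomial)
    then show "(\<lambda>t. g (cis t)) \<in> trig_polys"
      by (simp flip: complex_eq)
    show "norm (h t - g (cis t)) < e" if "t \<in> {0..2*pi}" for t
      using g(2)[of "cis t"] \<phi>[OF that] by simp
  qed
qed

text \<open>Symmetric ranges of frequencies are nested, so two sums can be added after padding their
  coefficients with zeros up to the larger range.\<close>

lemma trig_polys_sum:
  assumes "P \<in> trig_polys"
  shows "\<exists>c (N::nat). \<forall>t. P t = (\<Sum>n\<in>{- int N..int N}. c n * cis (of_int n * t))"
  using assms
proof induction
  case (cis n)
  have "(\<Sum>k\<in>{- int (nat \<bar>n\<bar>)..int (nat \<bar>n\<bar>)}. (if k = n then 1 else 0) * cis (of_int k * t)) = cis (of_int n * t)" for t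
    by (subst sum.cong[OF refl, where h = "\<lambda>k. if k = n then cis (of_int n * t) else 0"]) auto
  then show ?case by metis
next
  case (cmult P c)
  then obtain d N where "\<forall>t. P t = (\<Sum>n\<in>{- int N..int N}. d n * cis (of_int n * t))"
    by blast
  then have "\<forall>t. c * P t = (\<Sum>n\<in>{- int N..int N}. (c * d n) * cis (of_int n * t))"
    by (simp add: sum_distrib_left mult_ac)
  then show ?case by (intro exI)
next
  case (add P Q)
  then obtain c N d M where
    P: "\<And>t. P t = (\<Sum>n\<in>{- int N..int N}. c n * cis (of_int n * t))" and
    Q: "\<And>t. Q t = (\<Sum>n\<in>{- int M..int M}. d n * cis (of_int n * t))"
    by blast
  define L where "L = max N M"
  define c' where "c' n = (if n \<in> {- int N..int N} then c n else 0)" for n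
  define d' where "d' n = (if n \<in> {- int M..int M} then d n else 0)" for n
  have "P t = (\<Sum>n\<in>{- int L..int L}. c' n * cis (of_int n * t))" for t
    unfolding P by (rule sum.mono_neutral_cong_left) (auto simp: c'_def L_def)
  moreover have "Q t = (\<Sum>n\<in>{- int L..int L}. d' n * cis (of_int n * t))" for t
    unfolding Q by (rule sum.mono_neutral_cong_left) (auto simp: d'_def L_def)
  ultimately have "\<forall>t. P t + Q t = (\<Sum>n\<in>{- int L..int L}. (c' n + d' n) * cis (of_int n * t))"
    by (simp add: sum.distrib distrib_right)
  then show ?case by (intro exI)
qed

text \<open>For \<open>M > 0\<close> this is the radial projection onto the closed disc of radius
  \<open>M\<close>. Being continuous, it bounds continuous approximants without destroying their
  continuity.\<close>

definition clip :: "real \<Rightarrow> complex \<Rightarrow> complex" where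
  "clip M z = z / of_real (max 1 (norm z / M))"

lemma continuous_clip [continuous_intros]:
  "M > 0 \<Longrightarrow> continuous_on A f \<Longrightarrow> continuous_on A (\<lambda>x. clip M (f x))"
  unfolding clip_def by (intro continuous_intros) (auto simp: max_def split: if_splits)

lemma norm_clip_le: "M > 0 \<Longrightarrow> norm (clip M z) \<le> M"
  by (auto simp: clip_def norm_divide max_def field_simps split: if_splits)

lemma clip_eq: "norm z \<le> M \<Longrightarrow> M > 0 \<Longrightarrow> clip M z = z"
  by (simp add: clip_def max_def field_simps)

lemma norm_diff_clip_le: "M > 0 \<Longrightarrow> norm (z - clip M z) \<le> norm z"
proof -
  assume "M > 0"
  have "z - clip M z = of_real (1 - 1 / max 1 (norm z / M)) * z"
    by (simp add: clip_def algebra_simps)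
  moreover have "\<bar>1 - 1 / max 1 (norm z / M)\<bar> \<le> 1"
    by (simp add: abs_le_iff)
  ultimately show ?thesis
    by (simp add: norm_mult mult_left_le_one_le del: of_real_diff)
qed

section \<open>Mean-square approximation by trigonometric polynomials\<close>

lemma integral_norm_sq_add_le:
  assumes "sq_integrable F" "sq_integrable G"
  shows "(\<integral>t. (norm (F t + G t))\<^sup>2 \<partial>Tmeas) \<le>
    2 * (\<integral>t. (norm (F t))\<^sup>2 \<partial>Tmeas) + 2 * (\<integral>t. (norm (G t))\<^sup>2 \<partial>Tmeas)"
proof -
  have i: "integrable Tmeas (\<lambda>t. (norm (F t))\<^sup>2)" "integrable Tmeas (\<lambda>t. (norm (G t))\<^sup>2)"
      "integrable Tmeas (\<lambda>t. (norm (F t + G t))\<^sup>2)"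
    using assms sq_integrable_add[OF assms] by (auto simp: sq_integrable_def)
  have "(\<integral>t. (norm (F t + G t))\<^sup>2 \<partial>Tmeas) \<le> (\<integral>t. 2 * (norm (F t))\<^sup>2 + 2 * (norm (G t))\<^sup>2 \<partial>Tmeas)"
    using i by (intro integral_mono) (auto simp: norm_add_sq_le)
  then show ?thesis
    using i by simp
qed

lemma trig_polys_sq_integrable: "P \<in> trig_polys \<Longrightarrow> sq_integrable P"
  by (induction rule: trig_polys.induct) (auto intro: sq_integrable_add sq_integrable_cmult)

lemma AE_Tmeas_interior: "AE t in Tmeas. 0 < t \<and> t < 2 * pi"
proof -
  have "AE t in lebesgue. t \<noteq> 0" "AE t in lebesgue. t \<noteq> 2 * pi"
    by (rule AE_completion, rule AE_lborel_singleton)+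
  then have "AE t in lebesgue. t \<in> {0..2*pi} \<longrightarrow> 0 < t \<and> t < 2 * pi"
    by eventually_elim auto
  then show ?thesis
    unfolding Tmeas_def by (subst AE_restrict_space_iff) auto
qed

lemma integral_norm_sq_tendsto_0:
  assumes F: "\<And>k. F k \<in> borel_measurable Tmeas" "F' \<in> borel_measurable Tmeas"
    and W: "integrable Tmeas (\<lambda>t. (W t)\<^sup>2)"
    and le: "\<And>k. AE t in Tmeas. norm (F k t - F' t) \<le> W t"
    and lim: "AE t in Tmeas. (\<lambda>k. F k t) \<longlonglongrightarrow> (F' t :: complex)"
  shows "(\<lambda>k. \<integral>t. (norm (F k t - F' t))\<^sup>2 \<partial>Tmeas) \<longlonglongrightarrow> 0"
proof -
  have "(\<lambda>k. \<integral>t. (norm (F k t - F' t))\<^sup>2 \<partial>Tmeas) \<longlonglongrightarrow> (\<integral>t. 0 \<partial>Tmeas)"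
  proof (rule integral_dominated_convergence[where w = "\<lambda>t. (W t)\<^sup>2"])
    show "AE t in Tmeas. (\<lambda>k. (norm (F k t - F' t))\<^sup>2) \<longlonglongrightarrow> 0"
      using lim
    proof eventually_elim
      case (elim t)
      then have "(\<lambda>k. (norm (F k t - F' t))\<^sup>2) \<longlonglongrightarrow> (norm (F' t - F' t))\<^sup>2"
        by (intro tendsto_intros)
      then show ?case by simp
    qed
    show "AE t in Tmeas. norm ((norm (F k t - F' t))\<^sup>2) \<le> (W t)\<^sup>2" for k
      using le[of k] by eventually_elim (simp add: power_mono)
  qed (use F W in auto)
  then show ?thesis by simp
qed

text \<open>Three approximations are chained: \<open>F\<close> by its truncation
  \<open>clip M F\<close>, this by a continuous periodic \<open>h k\<close>, and \<open>h k\<close>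
  uniformly by a trigonometric polynomial. The first two converge by dominated convergence, the
  second because a measurable function is an almost everywhere limit of continuous ones.\<close>

lemma trig_polys_dense:
  assumes F: "sq_integrable F" and e: "e > 0"
  obtains P where "P \<in> trig_polys" "(\<integral>t. (norm (F t - P t))\<^sup>2 \<partial>Tmeas) < e"
proof -
  have Fm [measurable]: "F \<in> borel_measurable Tmeas" and Fi: "integrable Tmeas (\<lambda>t. (norm (F t))\<^sup>2)"
    using F by (auto simp: sq_integrable_def)
  have clipm: "(\<lambda>t. clip M (G t)) \<in> borel_measurable Tmeas"
    if "M > 0" "G \<in> borel_measurable Tmeas" for G M
    using borel_measurable_continuous_on[OF continuous_clip[OF that(1) continuous_on_id] that(2)] by simp
  have "(\<lambda>k. \<integral>t. (norm (clip (real (Suc k)) (F t) - F t))\<^sup>2 \<partial>Tmeas) \<longlonglongrightarrow> 0"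
  proof (rule integral_norm_sq_tendsto_0[where W = "\<lambda>t. norm (F t)"])
    show "AE t in Tmeas. (\<lambda>k. clip (real (Suc k)) (F t)) \<longlonglongrightarrow> F t"
    proof (rule AE_I2)
      fix t
      have "eventually (\<lambda>k. norm (F t) \<le> real (Suc k)) sequentially"
        using filterlim_compose[OF filterlim_real_sequentially filterlim_Suc]
        by (simp add: filterlim_at_top)
      then have "eventually (\<lambda>k. clip (real (Suc k)) (F t) = F t) sequentially"
        by eventually_elim (simp add: clip_eq)
      then show "(\<lambda>k. clip (real (Suc k)) (F t)) \<longlonglongrightarrow> F t"
        by (rule tendsto_eventually)
    qed
    show "AE t in Tmeas. norm (clip (real (Suc k)) (F t) - F t) \<le> norm (F t)" for k
      using norm_diff_clip_le[of "real (Suc k)"] by (simp add: norm_minus_commute)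
  qed (use Fi clipm[OF _ Fm] in auto)
  then have "eventually (\<lambda>k. (\<integral>t. (norm (clip (real (Suc k)) (F t) - F t))\<^sup>2 \<partial>Tmeas) < e / 8) sequentially"
    using e by (intro order_tendstoD) auto
  then obtain k0 where k0: "(\<integral>t. (norm (clip (real (Suc k0)) (F t) - F t))\<^sup>2 \<partial>Tmeas) < e / 8"
    using eventually_happens'[OF sequentially_bot] by blast
  define M where "M = real (Suc k0)"
  have M: "M > 0" "(\<integral>t. (norm (F t - clip M (F t)))\<^sup>2 \<partial>Tmeas) < e / 8"
    using k0 by (simp_all add: M_def norm_minus_commute)

  have "F \<in> borel_measurable (lebesgue_on {0..2*pi})"
    using Fm by (simp add: Tmeas_def)
  then have "(\<lambda>t. if t \<in> {0..2*pi} then F t else 0) \<in> borel_measurable lebesgue"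
    by (rule borel_measurable_if_I) auto
  then have "(\<lambda>t. if t \<in> {0..2*pi} then F t else 0) measurable_on UNIV"
    by (rule lebesgue_measurable_imp_measurable_on) auto
  then obtain N g where N: "negligible N" and g: "\<And>k. continuous_on UNIV (g k)"
    and gF: "\<And>t. t \<notin> N \<Longrightarrow> (\<lambda>k. g k t) \<longlonglongrightarrow> (if t \<in> {0..2*pi} then F t else 0)"
    unfolding measurable_on_def by auto
  \<comment> \<open>The real factor vanishes at 0 and \<open>2 * pi\<close>, which makes
    \<open>h k\<close> periodic. At each interior point it equals 1 for all large \<open>k\<close>,
    so the limit is unaffected almost everywhere.\<close>
  define h where "h k t = of_real (min 1 (real k * max 0 (t * (2 * pi - t)))) * clip M (g k t)" for k t
  have hcont: "continuous_on UNIV (h k)" for k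
    unfolding h_def by (intro continuous_intros M g)
  have h_le: "norm (h k t) \<le> M" for k t
  proof -
    have "\<bar>min 1 (real k * max 0 (t * (2 * pi - t)))\<bar> \<le> 1"
      by (simp add: abs_le_iff min_def)
    then show ?thesis
      unfolding h_def norm_mult norm_of_real
      using norm_clip_le[OF M(1), of "g k t"] by (meson abs_ge_zero mult_left_le_one_le norm_ge_zero order_trans)
  qed
  have "AE t in lebesgue. t \<in> {0..2*pi} \<longrightarrow> t \<notin> N"
    using AE_not_in[of N lebesgue] N by (auto simp: negligible_iff_null_sets)
  then have "AE t in Tmeas. t \<notin> N"
    unfolding Tmeas_def by (subst AE_restrict_space_iff) auto
  then have conv: "AE t in Tmeas. (\<lambda>k. h k t) \<longlonglongrightarrow> clip M (F t)"
    using AE_Tmeas_interior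
  proof eventually_elim
    case (elim t)
    define q where "q = t * (2 * pi - t)"
    have q: "q > 0"
      using elim by (simp add: q_def)
    obtain k0 where "1 / q < real k0"
      using reals_Archimedean2 by blast
    then have "1 \<le> real k * max 0 q" if "k \<ge> k0" for k
      using q that by (simp add: field_simps) (smt (verit) mult_left_mono of_nat_mono)
    then have "eventually (\<lambda>k. clip M (g k t) = h k t) sequentially"
      unfolding eventually_sequentially h_def q_def[symmetric] by (intro exI[of _ k0]) auto
    moreover have "(\<lambda>k. g k t) \<longlonglongrightarrow> F t"
      using gF[of t] elim by simp
    then have "(\<lambda>k. clip M (g k t)) \<longlonglongrightarrow> clip M (F t)"
      using continuous_clip[OF M(1) continuous_on_id, of UNIV]
      by (auto intro: continuous_on_tendsto_compose)
    ultimately show ?case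
      by (rule Lim_transform_eventually[rotated])
  qed
  have hm: "h k \<in> borel_measurable Tmeas" for k
    by (rule continuous_measurable_Tmeas[OF hcont])
  have "(\<lambda>k. \<integral>t. (norm (h k t - clip M (F t)))\<^sup>2 \<partial>Tmeas) \<longlonglongrightarrow> 0"
  proof (rule integral_norm_sq_tendsto_0[where W = "\<lambda>t. 2 * M"])
    show "AE t in Tmeas. norm (h k t - clip M (F t)) \<le> 2 * M" for k
    proof (rule AE_I2)
      fix t
      show "norm (h k t - clip M (F t)) \<le> 2 * M"
        using norm_triangle_ineq4[of "h k t" "clip M (F t)"] h_le[of k t] norm_clip_le[OF M(1), of "F t"]
        by linarith
    qed
  qed (use conv clipm[OF M(1) Fm] hm in auto)
  then have "eventually (\<lambda>k. (\<integral>t. (norm (h k t - clip M (F t)))\<^sup>2 \<partial>Tmeas) < e / 16) sequentially"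
    using e by (intro order_tendstoD) auto
  then obtain k where k': "(\<integral>t. (norm (h k t - clip M (F t)))\<^sup>2 \<partial>Tmeas) < e / 16"
    using eventually_happens'[OF sequentially_bot] by blast
  then have k: "(\<integral>t. (norm (clip M (F t) - h k t))\<^sup>2 \<partial>Tmeas) < e / 16"
    by (simp add: norm_minus_commute)

  \<comment> \<open>The uniform error is chosen so that its square integrates to
    \<open>e / 32\<close> over an interval of length \<open>2 * pi\<close>. Each use of the bound
    for the squared norm of a sum costs a factor 2, and the errors \<open>e / 8\<close>,
    \<open>e / 16\<close>, \<open>e / 32\<close> add up to \<open>5 * e / 8\<close>.\<close>
  define \<delta> where "\<delta> = sqrt (e / (32 * (2 * pi)))"
  have \<delta>: "\<delta> > 0" "\<delta>\<^sup>2 * (2 * pi) = e / 32"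
    using e by (auto simp: \<delta>_def)
  have "h k 0 = h k (2 * pi)"
    by (simp add: h_def)
  then obtain P where P: "P \<in> trig_polys" "\<And>t. t \<in> {0..2*pi} \<Longrightarrow> norm (h k t - P t) < \<delta>"
    using trig_polys_uniformly_dense[OF hcont _ \<delta>(1)] by blast
  have sF: "sq_integrable (\<lambda>t. clip M (F t))" "sq_integrable (h k)"
    using clipm[OF M(1) Fm] hm h_le norm_clip_le[OF M(1)] by (auto intro!: sq_integrable_bounded[where B = M])
  note sP = trig_polys_sq_integrable[OF P(1)]
  have "(\<integral>t. (norm (h k t - P t))\<^sup>2 \<partial>Tmeas) \<le> (\<integral>t. \<delta>\<^sup>2 \<partial>Tmeas)"
  proof (rule integral_mono)
    show "integrable Tmeas (\<lambda>t. (norm (h k t - P t))\<^sup>2)"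
      using sq_integrable_diff[OF sF(2) sP] by (simp add: sq_integrable_def)
    show "(norm (h k t - P t))\<^sup>2 \<le> \<delta>\<^sup>2" if "t \<in> space Tmeas" for t
      using P(2)[of t] that by (intro power_mono) auto
  qed simp
  then have hP: "(\<integral>t. (norm (h k t - P t))\<^sup>2 \<partial>Tmeas) \<le> e / 32"
    using \<delta>(2) by (simp add: integral_Tmeas_const mult.commute del: Bochner_Integration.lebesgue_integral_const)
  have cP: "(\<integral>t. (norm (clip M (F t) - P t))\<^sup>2 \<partial>Tmeas) \<le> 2 * (e / 16) + 2 * (e / 32)"
    using integral_norm_sq_add_le[OF sq_integrable_diff[OF sF(1) sF(2)] sq_integrable_diff[OF sF(2) sP]] hP k
    by simp
  have "(\<integral>t. (norm (F t - P t))\<^sup>2 \<partial>Tmeas) \<le>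
      2 * (\<integral>t. (norm (F t - clip M (F t)))\<^sup>2 \<partial>Tmeas) + 2 * (\<integral>t. (norm (clip M (F t) - P t))\<^sup>2 \<partial>Tmeas)"
    using integral_norm_sq_add_le[OF sq_integrable_diff[OF F sF(1)] sq_integrable_diff[OF sF(1) sP]]
    by simp
  also have "\<dots> < 2 * (e / 8) + 2 * (2 * (e / 16) + 2 * (e / 32))"
    using M(2) cP by simp
  also have "\<dots> \<le> e"
    using e by simp
  finally show thesis
    using P(1) that by blast
qed

section \<open>Fourier series and boundary values in the Hardy space\<close>

lemma integrable_L2T_cis:
  assumes "f \<in> L2T"
  shows "integrable Tmeas (\<lambda>t. f (cis t) * cis (x * t))"
  using sq_integrable_mult(1)[OF _ sq_integrable_cis] assms by (simp add: L2T_iff)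

lemma fourier_diff:
  assumes "f \<in> L2T" "g \<in> L2T"
  shows "fourier (\<lambda>z. f z - g z) n = fourier f n - fourier g n"
  using integrable_L2T_cis[OF assms(1), of "- of_int n"] integrable_L2T_cis[OF assms(2), of "- of_int n"]
  by (simp add: fourier_def left_diff_distrib diff_divide_distrib)

lemma fourier_cmult: "fourier (\<lambda>z. c * f z) n = c * fourier f n"
  by (simp add: fourier_def mult.assoc)

lemma H2D_diff:
  assumes "f \<in> H2D" "g \<in> H2D"
  shows "(\<lambda>z. f z - g z) \<in> H2D"
  using assms fourier_diff by (auto simp: H2D_def L2T_iff intro: sq_integrable_diff)

lemma H2D_cmult: "f \<in> H2D \<Longrightarrow> (\<lambda>z. c * f z) \<in> H2D"
  by (auto simp: H2D_def L2T_iff fourier_cmult intro: sq_integrable_cmult)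

lemma norm_diff_sq: "(norm (x - y))\<^sup>2 = (norm x)\<^sup>2 - 2 * Re (x * cnj y) + (norm (y :: complex))\<^sup>2"
  by (simp only: cmod_power2) (simp add: power2_eq_square algebra_simps)

text \<open>Completing the square, one frequency at a time. Since \<open>m\<close> is not in
  \<open>A\<close>, the residual \<open>G\<close> has the same coefficient at \<open>m\<close> as
  \<open>f\<close>, so subtracting the new term changes the squared norm by an amount involving only
  that coefficient. The choice \<open>c = fourier f\<close> gives Bessel's inequality, and a general
  \<open>c\<close> shows that this choice is the best approximation.\<close>

lemma integral_norm_sq_diff_trig:
  assumes f: "f \<in> L2T" and A: "finite A"
  shows "(\<integral>t. (norm (f (cis t) - (\<Sum>n\<in>A. c n * cis (of_int n * t))))\<^sup>2 \<partial>Tmeas) =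
    (\<integral>t. (norm (f (cis t)))\<^sup>2 \<partial>Tmeas) + 2 * pi * (\<Sum>n\<in>A. (norm (fourier f n - c n))\<^sup>2 - (norm (fourier f n))\<^sup>2)"
  using A
proof (induction A rule: finite_induct)
  case (insert m A)
  define S where "S t = (\<Sum>n\<in>A. c n * cis (of_int n * t))" for t
  define G where "G t = f (cis t) - S t" for t
  have S: "sq_integrable S"
    unfolding S_def by (intro sq_integrable_sum sq_integrable_cmult sq_integrable_cis)
  have G: "sq_integrable G"
    unfolding G_def using f S by (intro sq_integrable_diff) (auto simp: L2T_iff)
  have Gi: "integrable Tmeas (\<lambda>t. G t * cis (- of_int m * t))"
    by (rule sq_integrable_mult(1)[OF G sq_integrable_cis])
  have "(\<integral>t. S t * cis (- of_int m * t) \<partial>Tmeas) = (\<integral>t. (\<Sum>n\<in>A. c n * cis (of_int (n - m) * t)) \<partial>Tmeas)"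
    by (simp add: S_def sum_distrib_right mult.assoc cis_mult left_diff_distrib)
  also have "\<dots> = (\<Sum>n\<in>A. c n * (\<integral>t. cis (of_int (n - m) * t) \<partial>Tmeas))"
    by (subst Bochner_Integration.integral_sum)
       (auto intro!: sq_integrable_integrable sq_integrable_cmult sq_integrable_cis simp del: of_int_diff)
  also have "\<dots> = 0"
    using insert.hyps by (intro sum.neutral) (auto simp add: integral_cis simp del: of_int_diff)
  finally have "(\<integral>t. G t * cis (- of_int m * t) \<partial>Tmeas) = 2 * pi * fourier f m"
    unfolding G_def left_diff_distrib
    using integrable_L2T_cis[OF f, of "- of_int m"] sq_integrable_mult(1)[OF S sq_integrable_cis, of "- of_int m"]
    by (simp add: fourier_def)
  then have I: "(\<integral>t. cnj (c m) * (G t * cis (- of_int m * t)) \<partial>Tmeas) = of_real (2 * pi) * (cnj (c m) * fourier f m)"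
    by simp
  have re_scale: "Re (of_real x * z) = x * Re z" for x z
    by simp
  have re: "(\<integral>t. Re (cnj (c m) * (G t * cis (- of_int m * t))) \<partial>Tmeas) = 2 * pi * Re (cnj (c m) * fourier f m)"
    using integral_Re[OF integrable_mult_right[OF Gi, of "cnj (c m)"]] by (simp only: I re_scale)
  have "(\<integral>t. (norm (G t - c m * cis (of_int m * t)))\<^sup>2 \<partial>Tmeas) =
      (\<integral>t. (norm (G t))\<^sup>2 - 2 * Re (cnj (c m) * (G t * cis (- of_int m * t))) + (norm (c m))\<^sup>2 \<partial>Tmeas)"
    by (intro Bochner_Integration.integral_cong) (auto simp: norm_diff_sq norm_mult cis_cnj mult_ac)
  also have "\<dots> = (\<integral>t. (norm (G t))\<^sup>2 \<partial>Tmeas) - 2 * (2 * pi * Re (cnj (c m) * fourier f m)) + 2 * pi * (norm (c m))\<^sup>2"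
  proof -
    have "integrable Tmeas (\<lambda>t. (norm (G t))\<^sup>2)"
      using G by (simp add: sq_integrable_def)
    moreover have "integrable Tmeas (\<lambda>t. Re (cnj (c m) * (G t * cis (- of_int m * t))))"
      using Gi by (intro integrable_Re integrable_mult_right) auto
    moreover have "(\<integral>t. p t - 2 * q t + K \<partial>Tmeas) = (\<integral>t. p t \<partial>Tmeas) - 2 * (\<integral>t. q t \<partial>Tmeas) + 2 * pi * K"
      if "integrable Tmeas p" "integrable Tmeas q" for p q :: "real \<Rightarrow> real" and K
      using that by (simp add: integral_Tmeas_const del: Bochner_Integration.lebesgue_integral_const)
    ultimately show ?thesis
      unfolding re[symmetric] by blast
  qed
  also have "\<dots> = (\<integral>t. (norm (G t))\<^sup>2 \<partial>Tmeas) + 2 * pi * ((norm (fourier f m - c m))\<^sup>2 - (norm (fourier f m))\<^sup>2)"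
    by (simp add: norm_diff_sq algebra_simps)
  finally show ?case
    using insert.hyps insert.IH by (simp add: G_def S_def algebra_simps)
qed simp

lemma norm_fourier_le:
  assumes "f \<in> L2T"
  shows "2 * pi * (norm (fourier f n))\<^sup>2 \<le> (\<integral>t. (norm (f (cis t)))\<^sup>2 \<partial>Tmeas)"
proof -
  have "0 \<le> (\<integral>t. (norm (f (cis t) - (\<Sum>k\<in>{n}. fourier f k * cis (of_int k * t))))\<^sup>2 \<partial>Tmeas)"
    by simp
  then show ?thesis
    by (subst (asm) integral_norm_sq_diff_trig[OF assms]) auto
qed

section \<open>Fourier series of Hardy space functions\<close>

text \<open>Only nonnegative frequencies occur, which is the full expansion for elements of
  \<open>H2D\<close>.\<close>

definition fourier_sum :: "(complex \<Rightarrow> complex) \<Rightarrow> nat \<Rightarrow> real \<Rightarrow> complex" where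
  "fourier_sum f N t = (\<Sum>n<N. fourier f (int n) * cis (of_int (int n) * t))"

lemma sq_integrable_fourier_sum [simp]: "sq_integrable (fourier_sum f N)"
  unfolding fourier_sum_def by (intro sq_integrable_sum sq_integrable_cmult sq_integrable_cis)

lemma integral_norm_sq_diff_fourier_sum:
  assumes "f \<in> L2T"
  shows "(\<integral>t. (norm (f (cis t) - fourier_sum f N t))\<^sup>2 \<partial>Tmeas) =
    (\<integral>t. (norm (f (cis t)))\<^sup>2 \<partial>Tmeas) - 2 * pi * (\<Sum>n<N. (norm (fourier f (int n)))\<^sup>2)"
proof -
  have "fourier_sum f N = (\<lambda>t. \<Sum>n\<in>int ` {..<N}. fourier f n * cis (of_int n * t))"
    by (rule ext) (simp add: fourier_sum_def sum.reindex)
  then show ?thesis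
    by (simp only: integral_norm_sq_diff_trig[OF assms finite_imageI[OF finite_lessThan]])
       (simp add: sum.reindex sum_negf)
qed

text \<open>A trigonometric polynomial close to \<open>f\<close> exists by density. Its negative
  frequencies can only increase the error, as those coefficients of \<open>f\<close> vanish, and on
  the others the Fourier coefficients are optimal; so every partial sum reaching past its degree
  \<open>M\<close> is at least as close.\<close>

lemma fourier_sum_tendsto:
  assumes f: "f \<in> H2D"
  shows "(\<lambda>N. \<integral>t. (norm (f (cis t) - fourier_sum f N t))\<^sup>2 \<partial>Tmeas) \<longlonglongrightarrow> 0"
proof (rule LIMSEQ_I)
  fix e :: real
  assume e: "e > 0"
  have fL: "f \<in> L2T" and neg: "\<And>n. n < 0 \<Longrightarrow> fourier f n = 0"
    using f by (auto simp: H2D_def)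
  obtain P where P: "P \<in> trig_polys" "(\<integral>t. (norm (f (cis t) - P t))\<^sup>2 \<partial>Tmeas) < e"
    using trig_polys_dense[OF _ e] fL unfolding L2T_iff by blast
  obtain c M where c: "\<And>t. P t = (\<Sum>n\<in>{- int M..int M}. c n * cis (of_int n * t))"
    using trig_polys_sum[OF P(1)] by blast
  have "(\<integral>t. (norm (f (cis t) - fourier_sum f N t))\<^sup>2 \<partial>Tmeas) < e" if N: "N \<ge> Suc M" for N
  proof -
    have "(\<Sum>n\<in>{- int M..int M}. (norm (fourier f n))\<^sup>2) = (\<Sum>n\<in>int ` {..M}. (norm (fourier f n))\<^sup>2)"
    proof (rule sum.mono_neutral_right)
      show "\<forall>i\<in>{- int M..int M} - int ` {..M}. (norm (fourier f i))\<^sup>2 = 0"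
      proof
        fix i assume i: "i \<in> {- int M..int M} - int ` {..M}"
        have "i < 0"
        proof (rule ccontr)
          assume "\<not> i < 0"
          then have "i = int (nat i)" "nat i \<le> M" using i by auto
          then show False using i by blast
        qed
        then show "(norm (fourier f i))\<^sup>2 = 0" using neg by simp
      qed
    qed auto
    also have "\<dots> = (\<Sum>n\<le>M. (norm (fourier f (int n)))\<^sup>2)"
      by (simp add: sum.reindex)
    also have "\<dots> \<le> (\<Sum>n<N. (norm (fourier f (int n)))\<^sup>2)"
      using N by (intro sum_mono2) auto
    finally have le: "(\<Sum>n\<in>{- int M..int M}. (norm (fourier f n))\<^sup>2) \<le> (\<Sum>n<N. (norm (fourier f (int n)))\<^sup>2)" .
    have nn: "0 \<le> (\<Sum>n\<in>{- int M..int M}. (norm (fourier f n - c n))\<^sup>2)"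
      by (intro sum_nonneg) auto
    have "(\<Sum>n\<in>{- int M..int M}. (norm (fourier f n - c n))\<^sup>2 - (norm (fourier f n))\<^sup>2) \<ge>
        - (\<Sum>n<N. (norm (fourier f (int n)))\<^sup>2)"
      unfolding sum_subtractf using le nn by linarith
    then have "2 * pi * (\<Sum>n\<in>{- int M..int M}. (norm (fourier f n - c n))\<^sup>2 - (norm (fourier f n))\<^sup>2) \<ge>
        2 * pi * (- (\<Sum>n<N. (norm (fourier f (int n)))\<^sup>2))"
      by (rule mult_left_mono) simp
    then show ?thesis
      using P(2) unfolding c integral_norm_sq_diff_trig[OF fL finite_atLeastAtMost_int]
        integral_norm_sq_diff_fourier_sum[OF fL] by simp
  qed
  then show "\<exists>no. \<forall>N\<ge>no. norm ((\<integral>t. (norm (f (cis t) - fourier_sum f N t))\<^sup>2 \<partial>Tmeas) - 0) < e"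
    by (intro exI[of _ "Suc M"]) simp
qed

lemma Parseval_H2D:
  assumes f: "f \<in> H2D"
  shows "(\<lambda>n. 2 * pi * (norm (fourier f (int n)))\<^sup>2) sums (\<integral>t. (norm (f (cis t)))\<^sup>2 \<partial>Tmeas)"
proof -
  let ?I = "\<integral>t. (norm (f (cis t)))\<^sup>2 \<partial>Tmeas"
  have "f \<in> L2T" using f by (simp add: H2D_def)
  from integral_norm_sq_diff_fourier_sum[OF this]
  have "(\<lambda>N. ?I - (\<integral>t. (norm (f (cis t) - fourier_sum f N t))\<^sup>2 \<partial>Tmeas)) =
      (\<lambda>N. \<Sum>n<N. 2 * pi * (norm (fourier f (int n)))\<^sup>2)"
    by (simp add: sum_distrib_left)
  moreover have "(\<lambda>N. ?I - (\<integral>t. (norm (f (cis t) - fourier_sum f N t))\<^sup>2 \<partial>Tmeas)) \<longlonglongrightarrow> ?I - 0"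
    by (intro tendsto_intros fourier_sum_tendsto f)
  ultimately show ?thesis
    by (simp add: sums_def)
qed

text \<open>The hypothesis is a weak form of \<open>G\<close> lying in the Hardy space with mean
  \<open>K / (2 * pi)\<close>; the conclusion is that means multiply. It holds for partial sums,
  where only the constant term survives, and passes to the limit by continuity of the
  pairing.\<close>

lemma integral_H2D_mult:
  assumes f: "f \<in> H2D" and G: "sq_integrable G"
    and K: "\<And>n::nat. (\<integral>t. cis (of_int (int n) * t) * G t \<partial>Tmeas) = (if n = 0 then K else 0)"
  shows "(\<integral>t. f (cis t) * G t \<partial>Tmeas) = fourier f 0 * K"
proof -
  have fs: "sq_integrable (\<lambda>t. f (cis t))"
    using f by (simp add: H2D_def L2T_iff)
  have "(\<lambda>N. \<integral>t. fourier_sum f N t * G t \<partial>Tmeas) \<longlonglongrightarrow> (\<integral>t. f (cis t) * G t \<partial>Tmeas)"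
    using fourier_sum_tendsto[OF f]
    by (intro integral_mult_tendsto fs G sq_integrable_fourier_sum) (simp add: norm_minus_commute)
  moreover have "(\<integral>t. fourier_sum f N t * G t \<partial>Tmeas) = fourier f 0 * K" if "N \<ge> 1" for N
  proof -
    have "(\<integral>t. fourier_sum f N t * G t \<partial>Tmeas) =
        (\<integral>t. (\<Sum>n<N. fourier f (int n) * (cis (of_int (int n) * t) * G t)) \<partial>Tmeas)"
      by (simp add: fourier_sum_def sum_distrib_right mult.assoc)
    also have "\<dots> = (\<Sum>n<N. fourier f (int n) * (\<integral>t. cis (of_int (int n) * t) * G t \<partial>Tmeas))"
      by (subst Bochner_Integration.integral_sum)
         (auto intro!: integrable_mult_right sq_integrable_mult(1) sq_integrable_cis G simp del: of_int_of_nat_eq)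
    also have "\<dots> = (\<Sum>n<N. if n = 0 then fourier f 0 * K else 0)"
      by (intro sum.cong refl) (simp only: K, simp)
    also have "\<dots> = fourier f 0 * K"
      using that by simp
    finally show ?thesis .
  qed
  then have "(\<lambda>N. \<integral>t. fourier_sum f N t * G t \<partial>Tmeas) \<longlonglongrightarrow> fourier f 0 * K"
    by (intro tendsto_eventually eventually_sequentiallyI)
  ultimately show ?thesis
    by (rule LIMSEQ_unique)
qed

text \<open>The sum of the norms of the coefficients dominates all partial sums uniformly, so
  dominated convergence allows integration term by term and orthogonality picks out the frequency
  \<open>- k\<close>.\<close>

lemma trig_series:
  fixes c :: "nat \<Rightarrow> complex"
  assumes c: "summable (\<lambda>n. norm (c n))"
  defines "\<phi> \<equiv> \<lambda>t. \<Sum>n. c n * cis (of_int (int n) * t)"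
  shows "sq_integrable \<phi>"
    and "(\<integral>t. \<phi> t * cis (of_int k * t) \<partial>Tmeas) = (if k \<le> 0 then 2 * pi * c (nat (- k)) else 0)"
proof -
  define S where "S N t = (\<Sum>n<N. c n * cis (of_int (int n) * t))" for N t
  have S: "sq_integrable (S N)" for N
    unfolding S_def by (intro sq_integrable_sum sq_integrable_cmult sq_integrable_cis)
  have sm: "summable (\<lambda>n. c n * cis (of_int (int n) * t))" for t
    using c by (intro summable_norm_cancel[where f = "\<lambda>n. c n * cis (of_int (int n) * t)"]) (simp add: norm_mult)
  have S_lim: "(\<lambda>N. S N t) \<longlonglongrightarrow> \<phi> t" for t
    unfolding S_def \<phi>_def by (rule summable_LIMSEQ[OF sm])
  have S_le: "norm (S N t) \<le> (\<Sum>n. norm (c n))" for N t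
  proof -
    have "norm (S N t) \<le> (\<Sum>n<N. norm (c n))"
      unfolding S_def by (rule sum_norm_le) (simp add: norm_mult)
    also have "\<dots> \<le> (\<Sum>n. norm (c n))"
      using c by (intro sum_le_suminf) auto
    finally show ?thesis .
  qed
  have Sm [measurable]: "S N \<in> borel_measurable Tmeas" for N
    using S by (simp add: sq_integrable_def)
  have [measurable]: "\<phi> \<in> borel_measurable Tmeas"
    by (rule borel_measurable_LIMSEQ_metric[OF Sm S_lim])
  have "norm (\<phi> t) \<le> (\<Sum>n. norm (c n))" for t
    using Lim_bounded[OF tendsto_norm[OF S_lim]] S_le by blast
  then show "sq_integrable \<phi>"
    by (intro sq_integrable_bounded) auto
  have "(\<lambda>N. \<integral>t. S N t * cis (of_int k * t) \<partial>Tmeas) \<longlonglongrightarrow> (\<integral>t. \<phi> t * cis (of_int k * t) \<partial>Tmeas)"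
  proof (rule integral_dominated_convergence[where w = "\<lambda>t. \<Sum>n. norm (c n)"])
    show "AE t in Tmeas. (\<lambda>N. S N t * cis (of_int k * t)) \<longlonglongrightarrow> \<phi> t * cis (of_int k * t)"
      by (intro AE_I2 tendsto_intros S_lim)
    show "AE t in Tmeas. norm (S N t * cis (of_int k * t)) \<le> (\<Sum>n. norm (c n))" for N
      using S_le by (simp add: norm_mult)
  qed auto
  \<comment> \<open>Once \<open>N\<close> exceeds \<open>nat (- k)\<close>, the partial sum contains
    the only term that can contribute, so the sequence of integrals is eventually constant.\<close>
  moreover have "(\<integral>t. S N t * cis (of_int k * t) \<partial>Tmeas) = (if k \<le> 0 then 2 * pi * c (nat (- k)) else 0)"
    if N: "N > nat (- k)" for N
  proof -
    have "(\<integral>t. S N t * cis (of_int k * t) \<partial>Tmeas) = (\<integral>t. (\<Sum>n<N. c n * cis (of_int (int n + k) * t)) \<partial>Tmeas)"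
      by (simp add: S_def sum_distrib_right mult.assoc cis_mult distrib_right)
    also have "\<dots> = (\<Sum>n<N. c n * (\<integral>t. cis (of_int (int n + k) * t) \<partial>Tmeas))"
      by (subst Bochner_Integration.integral_sum)
         (auto intro!: sq_integrable_integrable sq_integrable_cmult sq_integrable_cis simp del: of_int_add)
    also have "\<dots> = (\<Sum>n<N. if n = nat (- k) then (if k \<le> 0 then 2 * pi * c (nat (- k)) else 0) else 0)"
      by (intro sum.cong refl) (auto simp only: integral_cis split: if_splits, auto)
    also have "\<dots> = (if k \<le> 0 then 2 * pi * c (nat (- k)) else 0)"
      using N by simp
    finally show ?thesis .
  qed
  then have "(\<lambda>N. \<integral>t. S N t * cis (of_int k * t) \<partial>Tmeas) \<longlonglongrightarrow> (if k \<le> 0 then 2 * pi * c (nat (- k)) else 0)"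
    by (intro tendsto_eventually eventually_sequentiallyI[of "Suc (nat (- k))"]) simp
  ultimately show "(\<integral>t. \<phi> t * cis (of_int k * t) \<partial>Tmeas) = (if k \<le> 0 then 2 * pi * c (nat (- k)) else 0)"
    by (rule LIMSEQ_unique)
qed

lemma norm_fourier_bound:
  assumes "f \<in> L2T"
  obtains B where "\<And>n. norm (fourier f n) \<le> B"
proof
  fix n
  have "norm (fourier f n) = sqrt ((norm (fourier f n))\<^sup>2)"
    by simp
  also have "\<dots> \<le> sqrt ((\<integral>t. (norm (f (cis t)))\<^sup>2 \<partial>Tmeas) / (2 * pi))"
    using norm_fourier_le[OF assms, of n] by (simp only: real_sqrt_le_iff) (simp add: field_simps)
  finally show "norm (fourier f n) \<le> sqrt ((\<integral>t. (norm (f (cis t)))\<^sup>2 \<partial>Tmeas) / (2 * pi))" .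
qed

section \<open>Power series in the disc and their dilations\<close>

lemma summable_H2ext:
  assumes f: "f \<in> L2T" and w: "norm w < 1"
  shows "summable (\<lambda>n. norm (fourier f (int n) * w ^ n))"
proof -
  obtain B where B: "\<And>n. norm (fourier f n) \<le> B"
    using norm_fourier_bound[OF f] by blast
  show ?thesis
  proof (rule summable_comparison_test')
    show "summable (\<lambda>n. B * norm w ^ n)"
      using w by (intro summable_mult summable_geometric) simp
    show "norm (norm (fourier f (int n) * w ^ n)) \<le> B * norm w ^ n" if "n \<ge> 0" for n
      by (simp add: norm_mult norm_power mult_right_mono B)
  qed
qed

lemma H2ext_sums:
  "f \<in> L2T \<Longrightarrow> norm w < 1 \<Longrightarrow> (\<lambda>n. fourier f (int n) * w ^ n) sums H2ext f w"
  unfolding H2ext_def by (intro summable_sums summable_norm_cancel[OF summable_H2ext])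

lemma H2ext_0 [simp]: "H2ext f 0 = fourier f 0"
  using powser_zero[of "\<lambda>n. fourier f (int n)"] by (simp add: H2ext_def)

lemma H2ext_holomorphic: "f \<in> L2T \<Longrightarrow> H2ext f holomorphic_on ball 0 1"
  using H2ext_sums by (intro power_series_holomorphic[where a = "\<lambda>n. fourier f (int n)"]) auto

lemma of_real_mult_cis_power: "(of_real r * cis t) ^ n = of_real (r ^ n) * cis (of_int (int n) * t)"
  by (simp add: power_mult_distrib Complex.DeMoivre)

text \<open>Inside the disc the power series converges absolutely, so its coefficients on the circle
  of radius \<open>r\<close> can be read off from \<open>trig_series\<close>.\<close>

lemma dilation_fourier:
  assumes f: "f \<in> L2T" and r: "0 \<le> r" "r < 1"
  shows "(\<lambda>z. H2ext f (of_real r * z)) \<in> L2T"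
    and "fourier (\<lambda>z. H2ext f (of_real r * z)) n = (if n \<ge> 0 then fourier f n * of_real (r ^ nat n) else 0)"
proof -
  define c where "c n = fourier f (int n) * of_real (r ^ n)" for n
  have c: "summable (\<lambda>n. norm (c n))"
    using summable_H2ext[OF f, of "of_real r"] r by (simp add: c_def)
  have eq: "H2ext f (of_real r * cis t) = (\<Sum>n. c n * cis (of_int (int n) * t))" for t
    unfolding H2ext_def c_def of_real_mult_cis_power by (simp only: mult.assoc)
  show "(\<lambda>z. H2ext f (of_real r * z)) \<in> L2T"
    unfolding L2T_iff eq by (rule trig_series(1)[OF c])
  show "fourier (\<lambda>z. H2ext f (of_real r * z)) n = (if n \<ge> 0 then fourier f n * of_real (r ^ nat n) else 0)"
  proof -
    have "fourier (\<lambda>z. H2ext f (of_real r * z)) n =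
        (1 / (2*pi)) * (\<integral>t. (\<Sum>n. c n * cis (of_int (int n) * t)) * cis (of_int (- n) * t) \<partial>Tmeas)"
      unfolding fourier_def[of "\<lambda>z. H2ext f (of_real r * z)"] eq by simp
    then show ?thesis
      unfolding trig_series(2)[OF c] by (simp add: c_def)
  qed
qed

lemma dilation_H2D:
  assumes f: "f \<in> L2T" and r: "0 \<le> r" "r < 1"
  shows "(\<lambda>z. H2ext f (of_real r * z)) \<in> H2D"
  using dilation_fourier[OF assms] by (auto simp: H2D_def)

text \<open>By Parseval the squared error is a series whose terms carry the factor
  \<open>(1 - r k ^ n)\<^sup>2\<close>. Each term tends to 0 and is dominated by the corresponding
  term for \<open>f\<close>, so Tannery's theorem applies.\<close>

lemma dilation_tendsto:
  assumes f: "f \<in> H2D" and r: "\<And>k. 0 \<le> r k" "\<And>k. r k < 1" "r \<longlonglongrightarrow> 1"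
  shows "(\<lambda>k. \<integral>t. (norm (H2ext f (of_real (r k) * cis t) - f (cis t)))\<^sup>2 \<partial>Tmeas) \<longlonglongrightarrow> 0"
proof -
  have fL: "f \<in> L2T" using f by (simp add: H2D_def)
  define a where "a n k = 2 * pi * ((norm (fourier f (int n)))\<^sup>2 * (1 - r k ^ n)\<^sup>2)" for n k
  have I: "(\<integral>t. (norm (H2ext f (of_real (r k) * cis t) - f (cis t)))\<^sup>2 \<partial>Tmeas) = (\<Sum>n. a n k)" for k
  proof -
    have "(\<lambda>n. 2 * pi * (norm (fourier (\<lambda>z. H2ext f (of_real (r k) * z) - f z) (int n)))\<^sup>2) sums
        (\<integral>t. (norm (H2ext f (of_real (r k) * cis t) - f (cis t)))\<^sup>2 \<partial>Tmeas)"
      by (rule Parseval_H2D[OF H2D_diff[OF dilation_H2D[OF fL r(1,2)] f]])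
    moreover have "2 * pi * (norm (fourier (\<lambda>z. H2ext f (of_real (r k) * z) - f z) (int n)))\<^sup>2 = a n k" for n
    proof -
      have "fourier (\<lambda>z. H2ext f (of_real (r k) * z) - f z) (int n) = fourier f (int n) * of_real (r k ^ n - 1)"
        using fourier_diff[OF dilation_fourier(1)[OF fL r(1,2)] fL] dilation_fourier(2)[OF fL r(1,2)]
        by (simp add: right_diff_distrib)
      then show ?thesis
        by (simp only: norm_mult norm_of_real power_mult_distrib power2_abs a_def power2_commute[of 1])
    qed
    ultimately show ?thesis
      by (simp add: sums_iff)
  qed
  have "(\<lambda>k. \<Sum>n. a n k) \<longlonglongrightarrow> (\<Sum>n. 0)"
  proof (rule tannerys_theorem[THEN conjunct2, THEN conjunct2])
    show "(\<lambda>k. a n k) \<longlonglongrightarrow> 0" for n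
    proof -
      have "(\<lambda>k. a n k) \<longlonglongrightarrow> 2 * pi * ((norm (fourier f (int n)))\<^sup>2 * (1 - 1 ^ n)\<^sup>2)"
        unfolding a_def by (intro tendsto_intros r)
      then show ?thesis by simp
    qed
    have "norm (a n k) \<le> 2 * pi * (norm (fourier f (int n)))\<^sup>2" for n k
    proof -
      have "(1 - r k ^ n)\<^sup>2 \<le> 1"
        using r(1,2)[of k] by (intro power_le_one) (auto simp: power_le_one)
      then show ?thesis
        by (simp add: a_def mult_left_le)
    qed
    then show "eventually (\<lambda>(n, k). norm (a n k) \<le> 2 * pi * (norm (fourier f (int n)))\<^sup>2)
        (at_top \<times>\<^sub>F sequentially)"
      by (intro always_eventually) auto
    show "summable (\<lambda>n. 2 * pi * (norm (fourier f (int n)))\<^sup>2)"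
      using Parseval_H2D[OF f] by (rule sums_summable)
  qed auto
  then show ?thesis
    by (simp add: I)
qed

section \<open>Boundary values and division by functions bounded below\<close>

definition radii :: "nat \<Rightarrow> real" where
  "radii k = 1 - 1 / (real k + 2)"

lemma radii: "0 \<le> radii k" "radii k < 1" "radii \<longlonglongrightarrow> 1"
proof -
  show "radii \<longlonglongrightarrow> 1"
    unfolding radii_def by real_asymp
qed (auto simp: radii_def)

text \<open>The deficit \<open>max 0 (\<delta> - norm g)\<close> on the circle is at most the
  distance from \<open>g\<close> to any of its dilations, which obey the lower bound. These
  distances tend to 0 in mean square, so the deficit vanishes almost everywhere; no pointwise radial
  limits are involved.\<close>

lemma boundary_norm_ge:
  assumes g: "g \<in> H2D" and \<delta>: "\<And>w. norm w < 1 \<Longrightarrow> \<delta> \<le> norm (H2ext g w)"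
  shows "AE t in Tmeas. \<delta> \<le> norm (g (cis t))"
proof -
  have gL: "g \<in> L2T" using g by (simp add: H2D_def)
  then have [measurable]: "(\<lambda>t. g (cis t)) \<in> borel_measurable Tmeas"
    by (simp add: L2T_iff sq_integrable_def)
  let ?u = "\<lambda>t. (max 0 (\<delta> - norm (g (cis t))))\<^sup>2"
  let ?I = "\<lambda>k. \<integral>t. (norm (H2ext g (of_real (radii k) * cis t) - g (cis t)))\<^sup>2 \<partial>Tmeas"
  have u: "integrable Tmeas ?u"
  proof (rule Tmeas.integrable_const_bound[where B = "\<delta>\<^sup>2"])
    have "?u t \<le> \<bar>\<delta>\<bar>\<^sup>2" for t
      using norm_ge_zero[of "g (cis t)"] by (intro power_mono) linarith+
    then show "AE t in Tmeas. norm (?u t) \<le> \<delta>\<^sup>2" by simp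
  qed measurable
  have le: "(\<integral>t. ?u t \<partial>Tmeas) \<le> ?I k" for k
  proof (rule integral_mono[OF u])
    have "sq_integrable (\<lambda>t. H2ext g (of_real (radii k) * cis t) - g (cis t))"
      using dilation_fourier(1)[OF gL radii(1,2)] gL unfolding L2T_iff by (intro sq_integrable_diff)
    then show "integrable Tmeas (\<lambda>t. (norm (H2ext g (of_real (radii k) * cis t) - g (cis t)))\<^sup>2)"
      by (simp add: sq_integrable_def)
    fix t
    have "\<delta> \<le> norm (H2ext g (of_real (radii k) * cis t))"
      using radii(1,2)[of k] by (intro \<delta>) (simp add: norm_mult)
    then have "max 0 (\<delta> - norm (g (cis t))) \<le> norm (H2ext g (of_real (radii k) * cis t) - g (cis t))"
      using norm_triangle_ineq2[of "H2ext g (of_real (radii k) * cis t)" "g (cis t)"] by simp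
    then show "?u t \<le> (norm (H2ext g (of_real (radii k) * cis t) - g (cis t)))\<^sup>2"
      by (rule power_mono) simp
  qed
  have "(\<integral>t. ?u t \<partial>Tmeas) \<le> 0"
    using LIMSEQ_le_const[OF dilation_tendsto[OF g radii]] le by blast
  then have "(\<integral>t. ?u t \<partial>Tmeas) = 0"
    by (intro antisym) simp_all
  then have "AE t in Tmeas. ?u t = 0"
    using u by (subst (asm) integral_nonneg_eq_0_iff_AE) auto
  then show ?thesis
    by eventually_elim auto
qed

text \<open>These are the moments expected of an element of the Hardy space with mean
  \<open>1 / fourier g 0\<close>. The reciprocal of the extension of \<open>g\<close> is holomorphic
  in the disc, its dilations \<open>F k\<close> have absolutely convergent Taylor series with the
  required moments, and they converge in mean square to the boundary function
  \<open>1 / g\<close>.\<close>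

lemma integral_cis_divide:
  assumes g: "g \<in> H2D" and \<delta>: "\<delta> > 0" "\<And>w. norm w < 1 \<Longrightarrow> \<delta> \<le> norm (H2ext g w)"
  shows "sq_integrable (\<lambda>t. 1 / g (cis t))"
    and "(\<integral>t. cis (of_int (int n) * t) * (1 / g (cis t)) \<partial>Tmeas) = (if n = 0 then 2 * pi / fourier g 0 else 0)"
proof -
  have gL: "g \<in> L2T" using g by (simp add: H2D_def)
  then have gm [measurable]: "(\<lambda>t. g (cis t)) \<in> borel_measurable Tmeas"
    by (simp add: L2T_iff sq_integrable_def)
  have ge: "AE t in Tmeas. \<delta> \<le> norm (g (cis t))"
    using \<delta>(2) by (rule boundary_norm_ge[OF g])
  have "AE t in Tmeas. norm (1 / g (cis t)) \<le> 1 / \<delta>"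
    using ge by eventually_elim (use \<delta>(1) in \<open>auto simp: norm_divide intro!: frac_le\<close>)
  then show s: "sq_integrable (\<lambda>t. 1 / g (cis t))"
    by (intro sq_integrable_bounded) measurable
  define F where "F k t = 1 / H2ext g (of_real (radii k) * cis t)" for k t
  have in_ball: "norm (of_real (radii k) * cis t) < 1" for k t
    using radii(1,2)[of k] by (simp add: norm_mult)
  have nz: "H2ext g w \<noteq> 0" if "norm w < 1" for w
    using \<delta>(1) \<delta>(2)[OF that] by auto
  have mean: "sq_integrable (F k) \<and> (\<integral>t. F k t * cis (of_int (int n) * t) \<partial>Tmeas) = (if n = 0 then 2 * pi / fourier g 0 else 0)" for k
  proof -
    define h where "h w = 1 / H2ext g w" for w
    define a where "a m = (deriv ^^ m) h 0 / fact m" for m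
    have "h holomorphic_on ball 0 1"
      unfolding h_def using nz by (intro holomorphic_intros H2ext_holomorphic gL) auto
    then have a: "(\<lambda>m. a m * w ^ m) sums h w" if "norm w < 1" for w
      using holomorphic_power_series[of h 0 1 w] that by (simp add: a_def)
    have sm: "summable (\<lambda>m. norm (a m * of_real (radii k ^ m)))"
    proof -
      \<comment> \<open>Convergence at the next larger radius, still inside the disc, yields
        absolute convergence at radius \<open>radii k\<close>.\<close>
      have "summable (\<lambda>m. a m * of_real (radii (Suc k)) ^ m)"
        using radii(1,2)[of "Suc k"] by (intro sums_summable[OF a]) simp
      then have "summable (\<lambda>m. norm (a m * of_real (radii k) ^ m))"
      proof (rule powser_insidea)
        have "radii k < radii (Suc k)"
          by (simp add: radii_def field_simps)
        then show "norm (complex_of_real (radii k)) < norm (complex_of_real (radii (Suc k)))"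
          using radii(1)[of k] radii(1)[of "Suc k"] by simp
      qed
      then show ?thesis by simp
    qed
    have "F k = (\<lambda>t. \<Sum>m. (a m * of_real (radii k ^ m)) * cis (of_int (int m) * t))"
      using sums_unique[OF a[OF in_ball]]
      unfolding F_def h_def of_real_mult_cis_power by (simp only: mult.assoc)
    then show ?thesis
      using trig_series(1)[OF sm] trig_series(2)[OF sm, of "int n"] by (auto simp: a_def h_def)
  qed
  have "(\<lambda>k. \<integral>t. (norm (F k t - 1 / g (cis t)))\<^sup>2 \<partial>Tmeas) \<longlonglongrightarrow> 0"
  proof (rule tendsto_sandwich[OF _ _ tendsto_const])
    let ?I = "\<lambda>k. \<integral>t. (norm (H2ext g (of_real (radii k) * cis t) - g (cis t)))\<^sup>2 \<partial>Tmeas"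
    \<comment> \<open>Inversion has Lipschitz constant \<open>1 / \<delta>\<^sup>2\<close> on
      numbers of modulus at least \<open>\<delta>\<close>; the factor is its square.\<close>
    show "(\<lambda>k. (1 / \<delta> ^ 4) * ?I k) \<longlonglongrightarrow> 0"
      by (rule tendsto_mult_right_zero[OF dilation_tendsto[OF g radii]])
    have "(\<integral>t. (norm (F k t - 1 / g (cis t)))\<^sup>2 \<partial>Tmeas) \<le> (1 / \<delta> ^ 4) * ?I k" for k
    proof -
      have "(\<integral>t. (norm (F k t - 1 / g (cis t)))\<^sup>2 \<partial>Tmeas) \<le>
          (\<integral>t. (1 / \<delta> ^ 4) * (norm (H2ext g (of_real (radii k) * cis t) - g (cis t)))\<^sup>2 \<partial>Tmeas)"
      proof (rule integral_mono_AE)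
        show "integrable Tmeas (\<lambda>t. (norm (F k t - 1 / g (cis t)))\<^sup>2)"
          using sq_integrable_diff[of "F k", OF _ s] mean by (simp add: sq_integrable_def)
        have "sq_integrable (\<lambda>t. H2ext g (of_real (radii k) * cis t) - g (cis t))"
          using dilation_fourier(1)[OF gL radii(1,2)] gL unfolding L2T_iff by (intro sq_integrable_diff)
        then show "integrable Tmeas (\<lambda>t. (1 / \<delta> ^ 4) * (norm (H2ext g (of_real (radii k) * cis t) - g (cis t)))\<^sup>2)"
          by (simp add: sq_integrable_def)
        show "AE t in Tmeas. (norm (F k t - 1 / g (cis t)))\<^sup>2 \<le>
            (1 / \<delta> ^ 4) * (norm (H2ext g (of_real (radii k) * cis t) - g (cis t)))\<^sup>2"
          using ge
        proof eventually_elim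
          case (elim t)
          define u v where "u = H2ext g (of_real (radii k) * cis t)" and "v = g (cis t)"
          have uv: "\<delta> \<le> norm u" "\<delta> \<le> norm v"
            using \<delta>(2)[OF in_ball] elim by (auto simp: u_def v_def)
          then have "u \<noteq> 0" "v \<noteq> 0"
            using \<delta>(1) by auto
          then have "norm (1 / u - 1 / v) = norm (u - v) / (norm u * norm v)"
            by (simp add: diff_frac_eq norm_divide norm_mult norm_minus_commute)
          also have "\<dots> \<le> norm (u - v) / (\<delta> * \<delta>)"
            using uv \<delta>(1) by (intro divide_left_mono mult_mono mult_pos_pos) auto
          finally have "(norm (1 / u - 1 / v))\<^sup>2 \<le> (norm (u - v) / (\<delta> * \<delta>))\<^sup>2"
            by (rule power_mono) simp
          then show ?case
            by (simp add: F_def u_def v_def power_divide power_mult_distrib flip: power_add)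
        qed
      qed
      then show ?thesis by simp
    qed
    then show "\<forall>\<^sub>F k in sequentially. (\<integral>t. (norm (F k t - 1 / g (cis t)))\<^sup>2 \<partial>Tmeas) \<le> (1 / \<delta> ^ 4) * ?I k"
      by simp
  qed simp
  then have "(\<lambda>k. \<integral>t. F k t * cis (of_int (int n) * t) \<partial>Tmeas) \<longlonglongrightarrow> (\<integral>t. 1 / g (cis t) * cis (of_int (int n) * t) \<partial>Tmeas)"
    using mean s by (intro integral_mult_tendsto sq_integrable_cis) auto
  then have "(\<lambda>k::nat. if n = 0 then 2 * pi / fourier g 0 else 0) \<longlonglongrightarrow> (\<integral>t. 1 / g (cis t) * cis (of_int (int n) * t) \<partial>Tmeas)"
    using mean by simp
  then have "(\<integral>t. 1 / g (cis t) * cis (of_int (int n) * t) \<partial>Tmeas) = (if n = 0 then 2 * pi / fourier g 0 else 0)"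
    using LIMSEQ_unique tendsto_const by blast
  then show "(\<integral>t. cis (of_int (int n) * t) * (1 / g (cis t)) \<partial>Tmeas) = (if n = 0 then 2 * pi / fourier g 0 else 0)"
    by (simp only: mult.commute)
qed

text \<open>Multiplicativity of means is applied twice: first to \<open>w\<close> against
  \<open>1 / g\<close> times a character, which gives the moments of \<open>w / g\<close>, then to
  \<open>f\<close> against \<open>w / g\<close>. Grouping the bounded factor \<open>1 / g\<close>
  with \<open>w\<close> keeps both sides of each pairing square-integrable.\<close>

lemma integral_H2D_quotient:
  assumes f: "f \<in> H2D" and w: "w \<in> H2D" and g: "g \<in> H2D"
    and \<delta>: "\<delta> > 0" "\<And>z. norm z < 1 \<Longrightarrow> \<delta> \<le> norm (H2ext g z)"
  shows "integrable Tmeas (\<lambda>t. f (cis t) / g (cis t) * w (cis t))"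
    and "(\<integral>t. f (cis t) / g (cis t) * w (cis t) \<partial>Tmeas) = 2 * pi * (fourier f 0 / fourier g 0 * fourier w 0)"
proof -
  have fs: "sq_integrable (\<lambda>t. f (cis t))" and ws: "sq_integrable (\<lambda>t. w (cis t))"
    using f w by (auto simp: H2D_def L2T_iff)
  note inv = integral_cis_divide[OF g \<delta>]
  have inv_m: "(\<lambda>t. 1 / g (cis t)) \<in> borel_measurable Tmeas"
    using inv(1) by (simp add: sq_integrable_def)
  have "AE t in Tmeas. \<delta> \<le> norm (g (cis t))"
    using \<delta>(2) by (rule boundary_norm_ge[OF g])
  then have inv_b: "AE t in Tmeas. norm (1 / g (cis t)) \<le> 1 / \<delta>"
    by eventually_elim (use \<delta>(1) in \<open>auto simp: norm_divide intro!: frac_le\<close>)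
  have wg: "sq_integrable (\<lambda>t. w (cis t) * (1 / g (cis t)))"
    by (rule sq_integrable_bounded_mult[OF ws inv_m inv_b])
  have "integrable Tmeas (\<lambda>t. f (cis t) * (w (cis t) * (1 / g (cis t))))"
    by (rule sq_integrable_mult(1)[OF fs wg])
  then show "integrable Tmeas (\<lambda>t. f (cis t) / g (cis t) * w (cis t))"
    by simp
  have "(\<integral>t. cis (of_int (int n) * t) * (w (cis t) * (1 / g (cis t))) \<partial>Tmeas) =
      (if n = 0 then fourier w 0 * (2 * pi / fourier g 0) else 0)" for n
  proof -
    let ?G = "\<lambda>t. cis (of_int (int n) * t) * (1 / g (cis t))"
    have "sq_integrable ?G"
      by (rule sq_integrable_bounded_mult[OF sq_integrable_cis inv_m inv_b])
    moreover have "(\<integral>t. cis (of_int (int m) * t) * ?G t \<partial>Tmeas) =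
        (if m = 0 then (if n = 0 then 2 * pi / fourier g 0 else 0) else 0)" for m
      \<comment> \<open>The frequencies are natural numbers, so \<open>m + n\<close> is 0 exactly
        when both are.\<close>
      using inv(2)[of "m + n"] by (simp add: cis_mult flip: mult.assoc distrib_right)
    ultimately have "(\<integral>t. w (cis t) * ?G t \<partial>Tmeas) = fourier w 0 * (if n = 0 then 2 * pi / fourier g 0 else 0)"
      by (rule integral_H2D_mult[OF w])
    then show ?thesis
      by (simp add: mult_ac)
  qed
  from integral_H2D_mult[OF f wg this]
  show "(\<integral>t. f (cis t) / g (cis t) * w (cis t) \<partial>Tmeas) = 2 * pi * (fourier f 0 / fourier g 0 * fourier w 0)"
    by (simp add: mult_ac)
qed

section \<open>The linear system for the right factor\<close>

lemma star_cis: "star f (cis t) = cnj (f (cis t))"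
  by (simp add: star_def cis_cnj flip: cis_inverse)

lemma Lset_norm_sq:
  assumes "(a, b) \<in> Lset"
  shows "AE t in Tmeas. (norm (a (cis t)))\<^sup>2 + (norm (b (cis t)))\<^sup>2 = 1"
proof -
  have "AE t in Tmeas. a (cis t) * star a (cis t) + b (cis t) * star b (cis t) = 1"
    using assms by (simp add: Lset_def)
  then show ?thesis
  proof eventually_elim
    case (elim t)
    then have "complex_of_real ((norm (a (cis t)))\<^sup>2 + (norm (b (cis t)))\<^sup>2) = of_real 1"
      by (simp only: star_cis flip: complex_norm_square) simp
    then show ?case
      by (simp only: of_real_eq_iff)
  qed
qed

lemma Lset_at_inf:
  assumes "(a, b) \<in> Lset"
  shows "fourier (star a) 0 = of_real (Re (at_inf a))" "Re (at_inf a) > 0"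
proof -
  have "at_inf a \<in> \<real>" and pos: "Re (at_inf a) > 0"
    using assms by (auto simp: Lset_def)
  then have "cnj (at_inf a) = of_real (Re (at_inf a))"
    by (auto elim: Reals_cases)
  then show "fourier (star a) 0 = of_real (Re (at_inf a))"
    by (simp add: at_inf_def)
  show "Re (at_inf a) > 0"
    by (rule pos)
qed

text \<open>Reflection in the unit circle carries the punctured disc to the exterior, and the origin
  corresponds to infinity, so the lower bound for \<open>a\<close> outside becomes one for
  \<open>star a\<close> inside.\<close>

lemma Beps_H2ext_ge:
  assumes "(a, b) \<in> Beps \<epsilon>" "norm w < 1"
  shows "2 powr (-1/2) + \<epsilon> \<le> norm (H2ext (star a) w)"
proof -
  let ?X = "{norm (ext_out a z) | z. norm z > 1} \<union> {norm (at_inf a)}"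
  have "norm (H2ext (star a) w) \<in> ?X"
  proof (cases "w = 0")
    case False
    have "norm (H2ext (star a) w) = norm (ext_out a (inverse (cnj w)))"
      by (simp add: ext_out_def)
    moreover have "norm (inverse (cnj w)) > 1"
      using False assms(2) by (simp add: norm_inverse one_less_inverse)
    ultimately show ?thesis by blast
  qed (simp add: at_inf_def)
  moreover have "bdd_below ?X"
    by (rule bdd_belowI[of _ 0]) auto
  ultimately have "inf_Dstar_abs a \<le> norm (H2ext (star a) w)"
    unfolding inf_Dstar_abs_def by (rule cInf_lower)
  then show ?thesis
    using assms(1) by (auto simp: Beps_def)
qed

lemma L2T_unit_pair:
  assumes "Tmeasurable a" "Tmeasurable b" "AE t in Tmeas. (norm (a (cis t)))\<^sup>2 + (norm (b (cis t)))\<^sup>2 = 1"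
  shows "a \<in> L2T" "b \<in> L2T"
proof -
  have "AE t in Tmeas. norm (a (cis t)) \<le> 1 \<and> norm (b (cis t)) \<le> 1"
    using assms(3)
  proof eventually_elim
    case (elim t)
    then have "(norm (a (cis t)))\<^sup>2 \<le> 1" "(norm (b (cis t)))\<^sup>2 \<le> 1"
      using zero_le_power2[of "norm (a (cis t))"] zero_le_power2[of "norm (b (cis t))"] by linarith+
    then show ?case
      by (simp add: abs_square_le_1)
  qed
  then show "a \<in> L2T" "b \<in> L2T"
    using assms by (auto simp: L2T_iff Tmeasurable_def intro!: sq_integrable_bounded[where B = 1])
qed

lemma Lset_L2T:
  assumes "(a, b) \<in> Lset"
  shows "a \<in> L2T" "b \<in> L2T"
  using L2T_unit_pair[OF _ _ Lset_norm_sq[OF assms]] assms by (auto simp: Lset_def)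

text \<open>
  Here \<open>h\<close> and \<open>k\<close> are the boundary values of \<open>a\<^sub>-\<^sup>*/a\<^sup>*\<close> and \<open>b\<^sub>-\<^sup>*/a\<^sup>*\<close>. Instead of saying that
  they lie in the Hardy space with means \<open>1/s\<close> and 0, the definition records how they
  integrate against elements of the Hardy space.
\<close>
definition factor_equations where
  "factor_equations a b ap bp s h k \<longleftrightarrow> s > 0 \<and>
    Tmeasurable a \<and> Tmeasurable b \<and> Tmeasurable ap \<and> Tmeasurable bp \<and>
    star ap \<in> H2D \<and> bp \<in> H2D \<and>
    (AE t in Tmeas. 2 powr (-1/2) \<le> norm (a (cis t)) \<and>
      (norm (a (cis t)))\<^sup>2 + (norm (b (cis t)))\<^sup>2 = 1 \<and>
      (norm (ap (cis t)))\<^sup>2 + (norm (bp (cis t)))\<^sup>2 = 1 \<and>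
      h t = ap (cis t) + cnj (b (cis t) / a (cis t)) * bp (cis t) \<and>
      k t = cnj (b (cis t) / a (cis t) * ap (cis t) - bp (cis t))) \<and>
    (\<forall>w\<in>H2D. integrable Tmeas (\<lambda>t. h t * w (cis t)) \<and> integrable Tmeas (\<lambda>t. k t * w (cis t)) \<and>
      of_real s * (\<integral>t. h t * w (cis t) \<partial>Tmeas) = 2 * pi * fourier w 0 \<and>
      (\<integral>t. k t * w (cis t) \<partial>Tmeas) = 0)"

text \<open>The right factor is pointwise a unitary matrix of determinant 1, so the left factor can
  be solved for algebraically; dividing its adjoints by \<open>star a\<close> gives \<open>h\<close>
  and \<open>k\<close>. Their pairings come from \<open>integral_H2D_quotient\<close>, as
  \<open>star a\<close> is bounded below in the disc.\<close>

lemma factor_equations_exist: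
  assumes B: "(a, b) \<in> Beps \<epsilon>" "\<epsilon> > 0"
    and m: "(am, bm) \<in> H0star" and p: "(ap, bp) \<in> Hset"
    and eq: "pair_eq_ae (a, b) (pmul (am, bm) (ap, bp))"
  shows "\<exists>s h k. factor_equations a b ap bp s h k"
proof -
  have L: "(a, b) \<in> Lset" "(am, bm) \<in> Lset" "(ap, bp) \<in> Lset"
    using B m p by (auto simp: Beps_def Bset_def H0star_def Hset_def Hbar_def)
  have H: "star a \<in> H2D" "star am \<in> H2D" "star ap \<in> H2D" "bp \<in> H2D" "star bm \<in> H2D"
    using L m p by (auto simp: Lset_def H2Dstar_def Hset_def Hbar_def H0star_def)
  have bm0: "fourier (star bm) 0 = 0"
    using m by (simp add: H0star_def)
  define \<delta> :: real where "\<delta> = 2 powr (-1/2)"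
  have \<delta>: "\<delta> > 0" "\<And>z. norm z < 1 \<Longrightarrow> \<delta> \<le> norm (H2ext (star a) z)"
    using Beps_H2ext_ge[OF B(1)] B(2) by (force simp: \<delta>_def)+
  have "AE t in Tmeas. \<delta> \<le> norm (star a (cis t))"
    using \<delta>(2) by (rule boundary_norm_ge[OF H(1)])
  then have ge: "AE t in Tmeas. \<delta> \<le> norm (a (cis t))"
    by (simp add: star_cis)
  define s where "s = Re (at_inf a) / Re (at_inf am)"
  define h where "h t = star am (cis t) / star a (cis t)" for t
  define k where "k t = star bm (cis t) / star a (cis t)" for t
  have s: "s > 0"
    using Lset_at_inf(2)[OF L(1)] Lset_at_inf(2)[OF L(2)] by (simp add: s_def)
  have "AE t in Tmeas. \<delta> \<le> norm (a (cis t)) \<and>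
      (norm (a (cis t)))\<^sup>2 + (norm (b (cis t)))\<^sup>2 = 1 \<and>
      (norm (ap (cis t)))\<^sup>2 + (norm (bp (cis t)))\<^sup>2 = 1 \<and>
      h t = ap (cis t) + cnj (b (cis t) / a (cis t)) * bp (cis t) \<and>
      k t = cnj (b (cis t) / a (cis t) * ap (cis t) - bp (cis t))"
    using ge Lset_norm_sq[OF L(1)] Lset_norm_sq[OF L(3)] eq[unfolded pair_eq_ae_def pmul_def, simplified, THEN conjunct1]
       eq[unfolded pair_eq_ae_def pmul_def, simplified, THEN conjunct2]
  proof eventually_elim
    case (elim t)
    define A B P Q M N where "A = a (cis t)" and "B = b (cis t)" and "P = ap (cis t)" and "Q = bp (cis t)"
      and "M = am (cis t)" and "N = bm (cis t)"
    note defs = A_def B_def P_def Q_def M_def N_def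
    have A: "A = M * P - N * cnj Q" and B: "B = M * Q + N * cnj P"
      using elim by (simp_all add: defs star_cis)
    have "complex_of_real ((norm P)\<^sup>2 + (norm Q)\<^sup>2) = 1"
      using elim(3) by (simp add: defs)
    then have PQ: "P * cnj P + Q * cnj Q = 1"
      by (simp only: of_real_add complex_norm_square)
    have A0: "A \<noteq> 0"
      using elim(1) \<delta>(1) by (auto simp: defs)
    \<comment> \<open>This is multiplication of the product by the inverse of the right factor; the
      determinant \<open>P * cnj P + Q * cnj Q\<close> is 1.\<close>
    have "A * cnj P + B * cnj Q = M * (P * cnj P + Q * cnj Q)" "B * P - A * Q = N * (P * cnj P + Q * cnj Q)"
      unfolding A B by (simp_all add: algebra_simps)
    then have MN: "M = A * cnj P + B * cnj Q" "N = B * P - A * Q"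
      unfolding PQ by simp_all
    have "h t = cnj M / cnj A" "k t = cnj N / cnj A"
      by (simp_all add: h_def k_def star_cis defs)
    then have "h t = P + cnj (B / A) * Q" "k t = cnj (B / A * P - Q)"
      unfolding MN using A0 by (simp_all add: field_simps)
    then show ?case
      using elim by (simp add: defs)
  qed
  moreover have "integrable Tmeas (\<lambda>t. h t * w (cis t)) \<and> integrable Tmeas (\<lambda>t. k t * w (cis t)) \<and>
      of_real s * (\<integral>t. h t * w (cis t) \<partial>Tmeas) = 2 * pi * fourier w 0 \<and>
      (\<integral>t. k t * w (cis t) \<partial>Tmeas) = 0" if "w \<in> H2D" for w
    unfolding h_def k_def
    \<comment> \<open>The mean of \<open>h\<close> is the quotient of the values of
      \<open>am\<close> and \<open>a\<close> at infinity, that is \<open>1 / s\<close>, and the mean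
      of \<open>k\<close> is 0 because \<open>star bm\<close> vanishes at the origin.\<close>
    using integral_H2D_quotient[OF H(2) that H(1) \<delta>] integral_H2D_quotient[OF H(5) that H(1) \<delta>]
      Lset_at_inf[OF L(1)] Lset_at_inf[OF L(2)] by (simp add: bm0 s_def)
  ultimately have "factor_equations a b ap bp s h k"
    unfolding factor_equations_def \<delta>_def using s H L by (auto simp: Lset_def)
  then show ?thesis by blast
qed

section \<open>Pointwise inequalities and the stability estimate\<close>

text \<open>The cross-multiplied numerator equals \<open>b * (a' - a) + a * (b - b')\<close>, to
  which Cauchy-Schwarz with the unit vector \<open>(a, b)\<close> applies; the denominator is at
  least \<open>\<delta>\<^sup>2\<close> in modulus.\<close>

lemma norm_diff_quotient_sq_le:
  fixes a b a' b' :: complex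
  assumes a: "\<delta> \<le> norm a" "\<delta> \<le> norm a'" "\<delta> > 0" and ab: "(norm a)\<^sup>2 + (norm b)\<^sup>2 = 1"
  shows "(norm (b / a - b' / a'))\<^sup>2 \<le> ((norm (a - a'))\<^sup>2 + (norm (b - b'))\<^sup>2) / \<delta> ^ 4"
proof -
  have nz: "a \<noteq> 0" "a' \<noteq> 0"
    using a by auto
  have "norm (b * a' - b' * a) = norm (b * (a' - a) + a * (b - b'))"
    by (simp add: algebra_simps)
  also have "\<dots> \<le> norm b * norm (a - a') + norm a * norm (b - b')"
    using norm_triangle_ineq[of "b * (a' - a)" "a * (b - b')"] by (simp add: norm_mult norm_minus_commute)
  finally have "(norm (b * a' - b' * a))\<^sup>2 \<le> (norm b * norm (a - a') + norm a * norm (b - b'))\<^sup>2"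
    by (rule power_mono) simp
  also have "\<dots> \<le> ((norm a)\<^sup>2 + (norm b)\<^sup>2) * ((norm (a - a'))\<^sup>2 + (norm (b - b'))\<^sup>2)"
    \<comment> \<open>By Lagrange's identity this square is the difference of the two sides.\<close>
    using zero_le_power2[of "norm b * norm (b - b') - norm a * norm (a - a')"]
    by (simp add: power2_eq_square algebra_simps)
  finally have num: "(norm (b * a' - b' * a))\<^sup>2 \<le> (norm (a - a'))\<^sup>2 + (norm (b - b'))\<^sup>2"
    by (simp add: ab)
  have "\<delta> * \<delta> \<le> norm a * norm a'"
    using a by (intro mult_mono) auto
  then have "(\<delta> * \<delta>)\<^sup>2 \<le> (norm a * norm a')\<^sup>2"
    using a by (intro power_mono) auto
  then have den: "\<delta> ^ 4 \<le> (norm a * norm a')\<^sup>2"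
    by (simp add: power_mult_distrib flip: power_add)
  have "(norm (b / a - b' / a'))\<^sup>2 = (norm (b * a' - b' * a))\<^sup>2 / (norm a * norm a')\<^sup>2"
    using nz by (simp add: diff_frac_eq norm_divide norm_mult power_divide)
  also have "\<dots> \<le> ((norm (a - a'))\<^sup>2 + (norm (b - b'))\<^sup>2) / \<delta> ^ 4"
    using num den a(3) by (intro frac_le) auto
  finally show ?thesis .
qed

text \<open>Write \<open>u\<close>, \<open>v\<close>, \<open>d\<close> for the differences of
  \<open>A\<close>, \<open>B\<close>, \<open>r\<close>. The terms containing
  \<open>cnj r * v * cnj u\<close> cancel by antisymmetry, leaving the energy of
  \<open>(u, v)\<close> plus errors linear in \<open>d\<close>. The inequality
  \<open>2 * x * y \<le> x\<^sup>2 + y\<^sup>2\<close> absorbs these into half of the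
  energy.\<close>

lemma energy_pointwise:
  fixes A B A' B' r r' :: complex and s' :: real
  assumes "(norm A')\<^sup>2 + (norm B')\<^sup>2 = s'\<^sup>2"
  shows "(norm (A - A'))\<^sup>2 + (norm (B - B'))\<^sup>2 - s'\<^sup>2 * (norm (r - r'))\<^sup>2 \<le>
    2 * (Re (((A + cnj r * B) - (A' + cnj r' * B')) * cnj (A - A')) -
         Re (cnj ((r * A - B) - (r' * A' - B')) * (B - B')))"
proof -
  define d u v where "d = r - r'" and "u = A - A'" and "v = B - B'"
  define Z where "Z = Re (((A + cnj r * B) - (A' + cnj r' * B')) * cnj u) - Re (cnj ((r * A - B) - (r' * A' - B')) * v)"
  define p q where "p = Re (cnj d * B' * cnj u)" and "q = Re (cnj d * cnj A' * v)"
  have "Z = (norm u)\<^sup>2 + (norm v)\<^sup>2 + p - q"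
    unfolding cmod_power2 d_def u_def v_def p_def q_def Z_def by (simp add: power2_eq_square algebra_simps)
  moreover have "- p \<le> norm d * norm B' * norm u"
    using abs_Re_le_cmod[of "cnj d * B' * cnj u"] by (simp add: norm_mult p_def)
  moreover have "q \<le> norm d * norm A' * norm v"
    using abs_Re_le_cmod[of "cnj d * cnj A' * v"] by (simp add: norm_mult q_def)
  moreover have "2 * (norm d * norm B' * norm u) \<le> (norm d)\<^sup>2 * (norm B')\<^sup>2 + (norm u)\<^sup>2"
    using sum_squares_bound[of "norm d * norm B'" "norm u"] by (simp add: power_mult_distrib)
  moreover have "2 * (norm d * norm A' * norm v) \<le> (norm d)\<^sup>2 * (norm A')\<^sup>2 + (norm v)\<^sup>2"
    using sum_squares_bound[of "norm d * norm A'" "norm v"] by (simp add: power_mult_distrib)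
  moreover have "(norm d)\<^sup>2 * (norm A')\<^sup>2 + (norm d)\<^sup>2 * (norm B')\<^sup>2 = s'\<^sup>2 * (norm d)\<^sup>2"
    using assms by (simp flip: distrib_left)
  ultimately show ?thesis
    unfolding d_def[symmetric] u_def[symmetric] v_def[symmetric] Z_def[symmetric] by linarith
qed

text \<open>The right side minus the left side is exactly \<open>(s - s')\<^sup>2\<close>.\<close>

lemma scaled_unit_vectors_dist:
  fixes p q p' q' :: complex and s s' :: real
  assumes "(norm p)\<^sup>2 + (norm q)\<^sup>2 = 1" "(norm p')\<^sup>2 + (norm q')\<^sup>2 = 1"
  shows "s * s' * ((norm (p - p'))\<^sup>2 + (norm (q - q'))\<^sup>2) \<le>
    (norm (of_real s * p - of_real s' * p'))\<^sup>2 + (norm (of_real s * q - of_real s' * q'))\<^sup>2"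
proof -
  define c where "c = Re (p * cnj p') + Re (q * cnj q')"
  have "(norm (p - p'))\<^sup>2 + (norm (q - q'))\<^sup>2 = 2 - 2 * c"
    using assms by (simp add: norm_diff_sq c_def)
  then have l: "s * s' * ((norm (p - p'))\<^sup>2 + (norm (q - q'))\<^sup>2) = s * s' * (2 - 2 * c)"
    by simp
  have "(norm (of_real s * p - of_real s' * p'))\<^sup>2 + (norm (of_real s * q - of_real s' * q'))\<^sup>2 =
      s\<^sup>2 * ((norm p)\<^sup>2 + (norm q)\<^sup>2) + s'\<^sup>2 * ((norm p')\<^sup>2 + (norm q')\<^sup>2) - 2 * (s * s') * c"
    unfolding cmod_power2 c_def by (simp add: power2_eq_square algebra_simps)
  also have "\<dots> = s\<^sup>2 + s'\<^sup>2 - 2 * (s * s') * c"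
    by (simp only: assms)
  finally show ?thesis
    using l zero_le_power2[of "s - s'"] by (simp add: power2_eq_square algebra_simps)
qed

text \<open>The energy inequality for the rescaled solutions is integrated over the circle. Its
  right side then vanishes, because both rescaled systems have the same right-hand side and are
  tested with the difference of their solutions.\<close>

lemma factor_dist_le:
  assumes E: "factor_equations a b ap bp s h k" and E': "factor_equations a' b' ap' bp' s' h' k'"
    and "s' \<le> s"
  shows "(\<integral>t. (norm (ap (cis t) - ap' (cis t)))\<^sup>2 + (norm (bp (cis t) - bp' (cis t)))\<^sup>2 \<partial>Tmeas) \<le>
    4 * (\<integral>t. (norm (a (cis t) - a' (cis t)))\<^sup>2 + (norm (b (cis t) - b' (cis t)))\<^sup>2 \<partial>Tmeas)"
proof -
  let ?y = "\<lambda>t. (norm (ap (cis t) - ap' (cis t)))\<^sup>2 + (norm (bp (cis t) - bp' (cis t)))\<^sup>2"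
  let ?D = "\<lambda>t. (norm (a (cis t) - a' (cis t)))\<^sup>2 + (norm (b (cis t) - b' (cis t)))\<^sup>2"
  have s: "s > 0" "s' > 0"
    using E E' by (auto simp: factor_equations_def)
  have sq: "sq_integrable (\<lambda>t. a (cis t))" "sq_integrable (\<lambda>t. b (cis t))"
      "sq_integrable (\<lambda>t. ap (cis t))" "sq_integrable (\<lambda>t. bp (cis t))"
    if "factor_equations a b ap bp s h k" for a b ap bp s h k
    unfolding L2T_iff[symmetric] using that by (auto simp: factor_equations_def intro: L2T_unit_pair)
  have int: "integrable Tmeas (\<lambda>t. (norm (F t - G t))\<^sup>2)" if "sq_integrable F" "sq_integrable G" for F G
    using sq_integrable_diff[OF that] by (simp add: sq_integrable_def)
  have y: "integrable Tmeas ?y" and D: "integrable Tmeas ?D"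
    by (intro Bochner_Integration.integrable_add int sq[OF E] sq[OF E'])+
  \<comment> \<open>The test functions: on the circle \<open>w\<close> is the conjugate of
    \<open>A - A'\<close> and \<open>v\<close> is \<open>B - B'\<close> in the notation of the
    pointwise inequality. The conjugate is what lies in \<open>H2D\<close> in the first
    case.\<close>
  define w where "w z = of_real s * star ap z - of_real s' * star ap' z" for z
  define v where "v z = of_real s * bp z - of_real s' * bp' z" for z
  have wv: "w \<in> H2D" "v \<in> H2D"
    unfolding w_def v_def using E E' by (auto simp: factor_equations_def intro!: H2D_diff H2D_cmult)
  have i: "integrable Tmeas (\<lambda>t. h t * w (cis t))" "integrable Tmeas (\<lambda>t. k t * v (cis t))"
      "integrable Tmeas (\<lambda>t. h' t * w (cis t))" "integrable Tmeas (\<lambda>t. k' t * v (cis t))"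
    using E E' wv by (auto simp: factor_equations_def)
  define X where "X t = of_real s * (h t * w (cis t)) - of_real s' * (h' t * w (cis t))" for t
  define Y where "Y t = of_real s * (k t * v (cis t)) - of_real s' * (k' t * v (cis t))" for t
  have XY: "integrable Tmeas X" "integrable Tmeas Y"
    unfolding X_def Y_def using i by auto
  have "(\<integral>t. X t \<partial>Tmeas) = of_real s * (\<integral>t. h t * w (cis t) \<partial>Tmeas) - of_real s' * (\<integral>t. h' t * w (cis t) \<partial>Tmeas)"
    unfolding X_def using i by simp
  \<comment> \<open>Both scaled pairings equal \<open>2 * pi * fourier w 0\<close>, whatever
    \<open>s\<close> and \<open>s'\<close> are; this is why the solutions are rescaled.\<close>
  then have X0: "(\<integral>t. X t \<partial>Tmeas) = 0"
    using E E' wv(1) by (simp add: factor_equations_def)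
  have "(\<integral>t. Y t \<partial>Tmeas) = of_real s * (\<integral>t. k t * v (cis t) \<partial>Tmeas) - of_real s' * (\<integral>t. k' t * v (cis t) \<partial>Tmeas)"
    unfolding Y_def using i by simp
  then have Y0: "(\<integral>t. Y t \<partial>Tmeas) = 0"
    using E E' wv(2) by (simp add: factor_equations_def)
  have "AE t in Tmeas. s * s' * ?y t - 4 * s'\<^sup>2 * ?D t \<le> 2 * (Re (X t) - Re (Y t))"
    using conjunct1[OF conjunct2[OF conjunct2[OF conjunct2[OF conjunct2[OF conjunct2[OF conjunct2[OF conjunct2[OF E[unfolded factor_equations_def]]]]]]]]]
      conjunct1[OF conjunct2[OF conjunct2[OF conjunct2[OF conjunct2[OF conjunct2[OF conjunct2[OF conjunct2[OF E'[unfolded factor_equations_def]]]]]]]]]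
  proof eventually_elim
    case (elim t)
    define r r' where "r = b (cis t) / a (cis t)" and "r' = b' (cis t) / a' (cis t)"
    define A B A' B' where "A = of_real s * ap (cis t)" and "B = of_real s * bp (cis t)"
      and "A' = of_real s' * ap' (cis t)" and "B' = of_real s' * bp' (cis t)"
    have "(norm A')\<^sup>2 + (norm B')\<^sup>2 = s'\<^sup>2 * ((norm (ap' (cis t)))\<^sup>2 + (norm (bp' (cis t)))\<^sup>2)"
      by (simp add: A'_def B'_def norm_mult power_mult_distrib distrib_left)
    then have "(norm A')\<^sup>2 + (norm B')\<^sup>2 = s'\<^sup>2"
      using elim by simp
    note energy = energy_pointwise[OF this, of A B r r']
    have hk: "h t = ap (cis t) + cnj r * bp (cis t)" "h' t = ap' (cis t) + cnj r' * bp' (cis t)"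
        "k t = cnj (r * ap (cis t) - bp (cis t))" "k' t = cnj (r' * ap' (cis t) - bp' (cis t))"
      using elim by (simp_all add: r_def r'_def)
    have "X t = ((A + cnj r * B) - (A' + cnj r' * B')) * cnj (A - A')"
      unfolding X_def hk by (simp add: w_def star_cis A_def B_def A'_def B'_def algebra_simps)
    moreover have "Y t = cnj ((r * A - B) - (r' * A' - B')) * (B - B')"
      unfolding Y_def hk by (simp add: v_def A_def B_def A'_def B'_def algebra_simps)
    moreover have "s * s' * ?y t \<le> (norm (A - A'))\<^sup>2 + (norm (B - B'))\<^sup>2"
      unfolding A_def B_def A'_def B'_def using elim by (intro scaled_unit_vectors_dist) auto
    \<comment> \<open>The constant 4 is \<open>\<delta>\<close> to the power -4 for the lower bound
      \<open>\<delta> = 2 powr (-1/2)\<close> on both \<open>a\<close> and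
      \<open>a'\<close>.\<close>
    moreover have "s'\<^sup>2 * (norm (r - r'))\<^sup>2 \<le> s'\<^sup>2 * (4 * ?D t)"
    proof (rule mult_left_mono)
      have "2 powr (- 1 / 2) = (1 / sqrt 2 :: real)"
        using powr_minus_divide[of 2 "1/2 :: real"] by (simp add: powr_half_sqrt)
      moreover have "sqrt 2 ^ 4 = (4 :: real)"
        using power_mult[of "sqrt 2" 2 2] by simp
      ultimately have pow4: "(2 powr (- 1 / 2)) ^ 4 = (1 / 4 :: real)"
        by (simp add: power_divide)
      have "(norm (r - r'))\<^sup>2 \<le> ?D t / (2 powr (- 1 / 2)) ^ 4"
        unfolding r_def r'_def using elim by (intro norm_diff_quotient_sq_le) auto
      then show "(norm (r - r'))\<^sup>2 \<le> 4 * ?D t"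
        unfolding pow4 by simp
    qed simp
    ultimately show ?case
      using energy by (simp only:)
  qed
  then have "(\<integral>t. s * s' * ?y t - 4 * s'\<^sup>2 * ?D t \<partial>Tmeas) \<le> (\<integral>t. 2 * (Re (X t) - Re (Y t)) \<partial>Tmeas)"
    using y D XY by (intro integral_mono_AE integrable_mult_right Bochner_Integration.integrable_diff integrable_Re)
  also have "\<dots> = 0"
    using XY X0 Y0 by simp
  finally have le0: "(\<integral>t. s * s' * ?y t - 4 * s'\<^sup>2 * ?D t \<partial>Tmeas) \<le> 0" .
  define I J where "I = (\<integral>t. ?y t \<partial>Tmeas)" and "J = (\<integral>t. ?D t \<partial>Tmeas)"
  have "(\<integral>t. x * p t - z * q t \<partial>Tmeas) = x * (\<integral>t. p t \<partial>Tmeas) - z * (\<integral>t. q t \<partial>Tmeas)"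
    if "integrable Tmeas p" "integrable Tmeas q" for p q :: "real \<Rightarrow> real" and x z
    using that by simp
  from le0[unfolded this[OF y D]] have "s' * (s * I) \<le> s' * (s' * (4 * J))"
    unfolding I_def[symmetric] J_def[symmetric] by (simp add: power2_eq_square mult_ac)
  then have "s * I \<le> s' * (4 * J)"
    using s by simp
  \<comment> \<open>The energy bound carries the scale \<open>s'\<close> of the second solution
    only, so the ordering \<open>s' \<le> s\<close> removes both scales.\<close>
  also have "\<dots> \<le> s * (4 * J)"
    using \<open>s' \<le> s\<close> by (intro mult_right_mono) (simp_all add: J_def)
  finally show ?thesis
    using s by (simp add: I_def J_def)
qed

section \<open>The metric and the numerical constant\<close>

lemma Hdist_sq:
  assumes "(\<lambda>z. fst p z - fst q z) \<in> L2T" "(\<lambda>z. snd p z - snd q z) \<in> L2T"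
  shows "Hdist p q = sqrt ((1 / (2 * pi)) * (\<integral>t. (norm (fst p (cis t) - fst q (cis t)))\<^sup>2 +
    (norm (snd p (cis t) - snd q (cis t)))\<^sup>2 \<partial>Tmeas))"
  using assms by (simp add: Hdist_def L2norm_def L2T_iff sq_integrable_def add_divide_distrib)

lemma Hdist_commute: "Hdist p q = Hdist q p"
  by (simp add: Hdist_def L2norm_def norm_minus_commute)

lemma Hdist_factor_le:
  assumes E: "factor_equations a b ap bp s h k" "factor_equations a' b' ap' bp' s' h' k'" "s' \<le> s"
    and L: "(a, b) \<in> Lset" "(a', b') \<in> Lset" "(ap, bp) \<in> Lset" "(ap', bp') \<in> Lset"
  shows "Hdist (ap, bp) (ap', bp') \<le> 2 * Hdist (a, b) (a', b')"
proof -
  have L2: "(\<lambda>z. f z - g z) \<in> L2T" if "f \<in> L2T" "g \<in> L2T" for f g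
    using that unfolding L2T_iff by (rule sq_integrable_diff)
  have "Hdist (ap, bp) (ap', bp') \<le> sqrt (4 * ((1 / (2 * pi)) * (\<integral>t. (norm (a (cis t) - a' (cis t)))\<^sup>2 +
      (norm (b (cis t) - b' (cis t)))\<^sup>2 \<partial>Tmeas)))"
    using factor_dist_le[OF E] by (subst Hdist_sq) (auto intro!: L2 Lset_L2T[OF L(3)] Lset_L2T[OF L(4)] simp: field_simps)
  also have "\<dots> = 2 * Hdist (a, b) (a', b')"
    unfolding Hdist_sq[of "(a, b)" "(a', b')", simplified fst_conv snd_conv, OF L2[OF Lset_L2T(1)[OF L(1)] Lset_L2T(1)[OF L(2)]]
        L2[OF Lset_L2T(2)[OF L(1)] Lset_L2T(2)[OF L(2)]]]
    by (simp only: real_sqrt_mult real_sqrt_four)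
  finally show ?thesis .
qed

text \<open>Almost everywhere on the circle
  \<open>2 powr (-1/2) + \<epsilon> \<le> norm a \<le> 1\<close>, and \<open>2 powr (-1/2)\<close>
  is at least \<open>2 / 3\<close>. This crude bound suffices to compare the constant 2 with the
  stated one.\<close>

lemma Beps_le_third:
  assumes "(a, b) \<in> Beps \<epsilon>"
  shows "\<epsilon> \<le> 1 / 3"
proof -
  have L: "(a, b) \<in> Lset"
    using assms by (auto simp: Beps_def Bset_def)
  then have "star a \<in> H2D"
    by (simp add: Lset_def H2Dstar_def)
  then have "AE t in Tmeas. 2 powr (-1/2) + \<epsilon> \<le> norm (star a (cis t))"
    using Beps_H2ext_ge[OF assms] by (rule boundary_norm_ge)
  then have "AE t in Tmeas. 2 powr (-1/2) + \<epsilon> \<le> 1"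
    using Lset_norm_sq[OF L]
  proof eventually_elim
    case (elim t)
    then have "(norm (a (cis t)))\<^sup>2 \<le> 1"
      using zero_le_power2[of "norm (b (cis t))"] by linarith
    then show ?case
      using elim by (simp add: star_cis abs_square_le_1)
  qed
  \<comment> \<open>The circle has positive measure, so an inequality between constants that holds
    almost everywhere holds outright.\<close>
  moreover have "ae_filter Tmeas \<noteq> bot"
    by (simp add: ae_filter_eq_bot_iff Tmeas_def emeasure_restrict_space)
  ultimately have "2 powr (-1/2) + \<epsilon> \<le> 1"
    by (simp add: eventually_const)
  moreover have "2 / 3 \<le> (2 powr (-1/2) :: real)"
  proof -
    have "sqrt 2 \<le> 3 / 2"
      by (rule real_le_lsqrt) (auto simp: power2_eq_square)
    then show ?thesis
      by (simp add: powr_minus_divide powr_half_sqrt field_simps)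
  qed
  ultimately show ?thesis by simp
qed

theorem theorem7p4:
  fixes \<epsilon> :: real and a b a' b' am bm ap bp am' bm' ap' bp' :: "complex \<Rightarrow> complex"
  assumes "\<epsilon> > 0"
    and "(a, b) \<in> Beps \<epsilon>" and "(a', b') \<in> Beps \<epsilon>"
    and "(am, bm) \<in> H0star" and "(ap, bp) \<in> Hset"
    and "pair_eq_ae (a, b) (pmul (am, bm) (ap, bp))"
    and "(am', bm') \<in> H0star" and "(ap', bp') \<in> Hset"
    and "pair_eq_ae (a', b') (pmul (am', bm') (ap', bp'))"
  shows "Hdist (ap, bp) (ap', bp') \<le>
    (2 powr (5/2) + 4) * ((3 powr (3/2) / 2) * \<epsilon>) powr (-3/2) * Hdist (a, b) (a', b')"
proof -
  have L: "(a, b) \<in> Lset" "(a', b') \<in> Lset" "(ap, bp) \<in> Lset" "(ap', bp') \<in> Lset"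
    using assms by (auto simp: Beps_def Bset_def Hset_def Hbar_def)
  obtain s h k where E: "factor_equations a b ap bp s h k"
    using factor_equations_exist[OF assms(2,1,4,5,6)] by blast
  obtain s' h' k' where E': "factor_equations a' b' ap' bp' s' h' k'"
    using factor_equations_exist[OF assms(3,1,7,8,9)] by blast
  have main: "Hdist (ap, bp) (ap', bp') \<le> 2 * Hdist (a, b) (a', b')"
  \<comment> \<open>The estimate is symmetric in the two data, so they may be exchanged to make the
    first scale the larger.\<close>
  proof (cases "s' \<le> s")
    case True
    then show ?thesis by (rule Hdist_factor_le[OF E E' _ L])
  next
    case False
    then have "s \<le> s'" by simp
    then show ?thesis
      using Hdist_factor_le[OF E' E _ L(2,1,4,3)] by (simp add: Hdist_commute)
  qed
  define c where "c = (3 powr (3/2) / 2) * \<epsilon>"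
  have "3 powr (3/2) = 3 powr 1 * 3 powr (1/2 :: real)"
    using powr_add[of 3 1 "1/2 :: real"] by simp
  \<comment> \<open>Bounding \<open>sqrt 3\<close> by 2 gives
    \<open>c \<le> 3 * \<epsilon> \<le> 1\<close>, so the negative power of \<open>c\<close> is at
    least 1.\<close>
  also have "\<dots> \<le> 3 * (2 :: real)"
    by (simp add: powr_half_sqrt real_le_lsqrt)
  finally have "c \<le> 3 * (1 / 3)"
    unfolding c_def using assms(1) Beps_le_third[OF assms(2)] by (intro mult_mono) auto
  then have "1 \<le> c powr (-3/2)"
    using powr_mono2'[of "-3/2" c 1] assms(1) by (simp add: c_def)
  then have "2 * 1 \<le> (2 powr (5/2) + 4) * c powr (-3/2)"
    by (intro mult_mono) (auto intro: add_increasing)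
  then have "2 * Hdist (a, b) (a', b') \<le> (2 powr (5/2) + 4) * c powr (-3/2) * Hdist (a, b) (a', b')"
    by (intro mult_right_mono) (auto simp: Hdist_def)
  then show ?thesis
    using main by (simp add: c_def)
qed

end
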